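(* Let $n\in\mathbb{N}$, $\alpha\in\mathbb{R}$, $0<\mu\le 1$, let $\Omega\subset\mathbb{R}^{n+1}$ be an axially symmetric domain with smooth boundary, and let its projection $D\subset\mathbb{C}_+$ onto the $(x_0,r)$-plane, with boundary $\partial D$, be simply connected. Let $g\in\mathcal{H}^\mu(\partial\Omega,\mathbb{R})$. Then the solution to the problem of finding an axially monogenic function $\phi\in\mathcal{C}^1(\Omega,\mathbb{R}_{0,n})$ with $$(\mathcal{D}-\alpha)\phi(x)=0,\quad x\in\Omega,\qquad \mathrm{Re}\{\phi(t)\}=g(t),\quad t\in\partial\Omega,$$ has the form $$\phi(x)=\mathrm{e}^{\alpha x_0}\Big(\mathrm{Re}(w)(x_0,|\underline{x}|)+\underline{\omega}\,\mathrm{Im}(w)(x_0,|\underline{x}|)\Big),\quad x\in\Omega,$$ where $w$ is a complex-valued function on $D$ given by $w(z)=\Psi(z)\mathrm{e}^{\nu(z)}$ with $$\nu(z)=\frac1\pi\iint_D\left(\frac{(n-1)\mathrm{i}}{4\eta}-\frac{(n-1)\mathrm{i}}{4\eta}\frac{\overline{w(\rho)}}{w(\rho)}\right)\frac{\mathrm{d}\xi\,\mathrm{d}\eta}{\rho-z},\quad \rho=\xi+\mathrm{i}\eta,$$ and $\Psi(z)=\widehat\Psi[\psi(z)]$, where $\gamma=\psi(z)$ is a conformal map of $D$ onto the unit disk with inverse $z=\varphi(\gamma)$. Here $g_0=\mathrm{e}^{-\alpha x_0}g$, $\widehat g_0(\gamma)=g_0[\varphi(\gamma)]$, $\widehat\lambda(\gamma)=\lambda[\varphi(\gamma)]$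 with $\lambda=1$, $\widehat\nu(\gamma)=\nu[\varphi(\gamma)]$, $\widehat\lambda_0(\gamma)=\widehat\lambda(\gamma)\mathrm{e}^{\widehat\nu(\gamma)}=\mathrm{e}^{\widehat\nu(\gamma)}$, and the integer $m$ and the function $\widehat\chi=\widehat p+\mathrm{i}\widehat q$, analytic in $|\gamma|<1$, are given by the relation $$\widehat\lambda_0(\gamma)=|\widehat\lambda_0(\gamma)|\,\gamma^{-m}\mathrm{e}^{\widehat\chi(\gamma)}\mathrm{e}^{-\widehat p(\gamma)},\quad |\gamma|=1,$$ where the imaginary part of $\widehat\chi$ on $|\gamma|=1$ is $\widehat q(\gamma)=\arg\widehat\lambda_0(\gamma)+m\arg\gamma$ and $m$ is an integer making each branch of $\widehat q$ single-valued on $|\gamma|=1$. Put $$\widehat g_4(\gamma)=\frac{\widehat g_0(\gamma)\mathrm{e}^{\widehat p(\gamma)}}{|\mathrm{e}^{\widehat\nu(\gamma)}|}.$$ (i) If $m\ge0$, then $$\widehat\Psi(\gamma)=\frac{\gamma^m\mathrm{e}^{-\widehat\chi(\gamma)}}{2\pi\mathrm{i}}\int_{|t|=1}\widehat g_4(t)\frac{t+\gamma}{t-\gamma}\frac{\mathrm{d}t}{t}+\mathrm{e}^{-\widehat\chi(\gamma)}\sum_{k=0}^{2m}c_k\gamma^k,$$ where $c_0,\dots,c_{2m}$ are complex constants satisfying $c_{2m-k}=-\overline{c_k}$ for $k=0,1,\dots,m$. (ii) If $m<0$, then $\widehat\Psi$ is expressed by $$\widehat\Psi(\gamma)=\frac{\mathrm{e}^{-\widehat\chi(\gamma)}}{\pi\mathrm{i}}\int_{|t|=1}\frac{\widehat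 g_4(t)t^m\,\mathrm{d}t}{t-\gamma}$$ when and only when $$\int_0^{2\pi}\widehat g_4(\mathrm{e}^{\mathrm{i}\theta})\mathrm{e}^{-k\mathrm{i}\theta}\,\mathrm{d}\theta=0,\quad k=0,\dots,-m+1.$$
   Context: $\mathbb{R}_{0,n}$ is the real Clifford algebra generated by the orthonormal basis $e_1,\dots,e_n$ of $\mathbb{R}^n$ with $e_j^2=-1$ and $e_ie_j+e_je_i=0$ for $i\ne j$. Points of $\mathbb{R}^{n+1}$ are identified with $x=x_0+\underline{x}=x_0+\sum_{j=1}^n x_je_j$, with $\mathrm{Sc}(x)=x_0$; write $r=|\underline{x}|$ and $\underline{x}=r\underline{\omega}$ with $\underline{\omega}\in S^{n-1}=\{\underline{x}\in\mathbb{R}^n:|\underline{x}|=1\}$. An open set $\Omega$ is axially symmetric if for every $x\in\Omega$ the set $[x]=\{\mathrm{Sc}(x)+\mathcal{I}|\underline{x}|:\mathcal{I}\in S^{n-1}\}$ is contained in $\Omega$. $\mathbb{C}_+$ is the upper half of the $(x_0,r)$-plane, with complex coordinate $z=x_0+\mathrm{i}r$. The generalised Cauchy-Riemann operator is $\mathcal{D}=\partial_{x_0}+\sum_{j=1}^n e_j\partial_{x_j}$, and $\alpha$ in $\mathcal{D}-\alpha$ means $\alpha I$ with $I$ the identity operator. A continuously differentiable function $\phi$ is monogenic if $\mathcal{D}\phi=0$. A function is of axial type if $\phi(x)=A(x_0,r)+\underline{\omega}B(x_0,r)$ with $\mathbb{R}$-valued $A,B$; then $\mathrm{Re}\,\phi=A$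 and $\mathrm{Im}\,\phi=B$. An axially monogenic function is a monogenic function of axial type. $\mathcal{H}^\mu$ denotes the space of functions all of whose components are Hölder continuous with exponent $\mu$. All functions considered are of axial type, so $g$ depends only on $(x_0,r)$ and is also regarded as a function $g(z)$ of $z=x_0+\mathrm{i}r\in\partial D$. Here $\mathrm{Re}(w),\mathrm{Im}(w)$ are the usual real and imaginary parts of the complex-valued function $w$. The conformal map $\psi$ takes $D$ to $|\gamma|<1$ and $\partial D$ to $|\gamma|=1$. The function $\widehat\chi$ is the Schwarz integral $\widehat\chi(\gamma)=\frac1{2\pi}\int_{|\tau|=1}\widehat q(\tau)\frac{\tau+\gamma}{\tau-\gamma}\frac{\mathrm{d}\tau}{\tau}$, and $\widehat p=\mathrm{Re}\,\widehat\chi$. *)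

theory Defs
  imports "HOL-Complex_Analysis.Complex_Analysis"
begin

no_notation fps_nth (infixl \<open>$\<close> 75)

section \<open>The Clifford algebra $R_{0,n}$\<close>

text \<open>
  An element is given by its coordinates with respect to the basis of blades
  $e_A = e_{a_1} \cdots e_{a_k}$, where $A = \{a_1 < \dots < a_k\}$ ranges over the subsets of the
  index type. Multiplying $e_A$ by $e_B$ costs one sign for each pair $(a,b)$ with $b < a$
  (anticommutation) and one for each common index ($e_j^2 = -1$), hence one for each pair
  with $b \le a$.
\<close>

type_synonym 'n clifford = "real ^ 'n set"

definition blade :: "'n::{finite,linorder} set \<Rightarrow> 'n clifford"
  where "blade A = axis A 1"

definition blade_sign :: "'n::{finite,linorder} set \<Rightarrow> 'n set \<Rightarrow> real"
  where "blade_sign A B = (-1) ^ card {(a, b). a \<in> A \<and> b \<in> B \<and> b \<le> a}"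

definition cl_mult :: "'n::{finite,linorder} clifford \<Rightarrow> 'n clifford \<Rightarrow> 'n clifford"
    (infixl \<open>\<star>\<close> 70)
  where "x \<star> y = (\<Sum>A\<in>UNIV. \<Sum>B\<in>UNIV. (x $ A * y $ B * blade_sign A B) *\<^sub>R blade (sym_diff A B))"

definition cl_scalar :: "real \<Rightarrow> 'n::{finite,linorder} clifford"
  where "cl_scalar s = s *\<^sub>R blade {}"

definition cl_e :: "'n::{finite,linorder} \<Rightarrow> 'n clifford"
  where "cl_e j = blade {j}"

definition cl_vector :: "real ^ 'n::{finite,linorder} \<Rightarrow> 'n clifford"
  where "cl_vector v = (\<Sum>j\<in>UNIV. (v $ j) *\<^sub>R cl_e j)"

subsection \<open>The product is the associative unital product with the defining relations\<close>

lemma blade_sign_prod: "blade_sign A B = (\<Prod>a\<in>A. \<Prod>b\<in>B. if b \<le> a then -1 else 1)"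
proof -
  have "(\<Prod>b\<in>B. if b \<le> a then -1 else (1::real)) = (-1) ^ card {b\<in>B. b \<le> a}" for a
    by (simp add: prod.If_cases Int_def)
  moreover have "{(a, b). a \<in> A \<and> b \<in> B \<and> b \<le> a} = Sigma A (\<lambda>a. {b\<in>B. b \<le> a})"
    by auto
  ultimately show ?thesis
    by (simp add: blade_sign_def card_SigmaI power_sum)
qed

lemma prod_sym_diff_sign:
  fixes f :: "'a::finite \<Rightarrow> real"
  assumes "\<And>x. f x * f x = 1"
  shows "prod f (sym_diff A B) = prod f A * prod f B"
proof -
  have "prod f A = prod f (A - B) * prod f (A \<inter> B)"
    by (subst prod.union_disjoint [symmetric]) (auto intro: arg_cong [of _ _ "prod f"])
  moreover have "prod f B = prod f (B - A) * prod f (A \<inter> B)"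
    by (subst prod.union_disjoint [symmetric]) (auto intro: arg_cong [of _ _ "prod f"])
  moreover have "prod f (A \<inter> B) * prod f (A \<inter> B) = 1"
    using assms by (simp flip: prod.distrib)
  moreover have "prod f (sym_diff A B) = prod f (A - B) * prod f (B - A)"
    by (rule prod.union_disjoint) auto
  ultimately have "prod f A * prod f B = prod f (sym_diff A B) * 1"
    by (simp only: mult_ac)
  then show ?thesis by simp
qed

lemma blade_sign_left: "blade_sign (sym_diff A B) C = blade_sign A C * blade_sign B C"
  unfolding blade_sign_prod
  by (rule prod_sym_diff_sign) (auto simp flip: prod.distrib intro!: prod.neutral)

lemma blade_sign_right: "blade_sign A (sym_diff B C) = blade_sign A B * blade_sign A C"
proof -
  have "blade_sign A X = (\<Prod>b\<in>X. \<Prod>a\<in>A. if b \<le> a then -1 else 1)" for X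
    unfolding blade_sign_prod by (rule prod.swap)
  then show ?thesis
    by (simp only:) (rule prod_sym_diff_sign, auto simp flip: prod.distrib intro!: prod.neutral)
qed

lemma bounded_bilinear_cl_mult: "bounded_bilinear ((\<star>) :: 'n::{finite,linorder} clifford \<Rightarrow> _)"
proof -
  have "bilinear ((\<star>) :: 'n clifford \<Rightarrow> _)"
    unfolding bilinear_def
    by (intro conjI allI linearI)
       (simp_all add: cl_mult_def algebra_simps sum.distrib scaleR_sum_right)
  then show ?thesis by (simp add: bilinear_conv_bounded_bilinear)
qed

interpretation cl_mult: bounded_bilinear "(\<star>) :: 'n::{finite,linorder} clifford \<Rightarrow> _"
  by (rule bounded_bilinear_cl_mult)

lemma blade_mult: "blade A \<star> blade B = blade_sign A B *\<^sub>R blade (sym_diff A B)"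
proof -
  have "(\<Sum>B'\<in>UNIV. (blade A $ A' * blade B $ B' * blade_sign A' B') *\<^sub>R blade (sym_diff A' B')) =
      (if A' = A then blade_sign A B *\<^sub>R blade (sym_diff A B) else 0)" for A'
  proof -
    have "(blade A $ A' * blade B $ B' * blade_sign A' B') *\<^sub>R blade (sym_diff A' B') =
        (if B' = B then if A' = A then blade_sign A B *\<^sub>R blade (sym_diff A B) else 0 else 0)" for B'
      by (simp add: blade_def [of A] blade_def [of B] axis_def)
    then show ?thesis by simp
  qed
  then show ?thesis by (simp add: cl_mult_def)
qed

lemma cl_expand: "x = (\<Sum>A\<in>UNIV. (x $ A) *\<^sub>R blade A)"
  by (simp add: blade_def vec_eq_iff axis_def if_distrib cong: if_cong)

lemma cl_mult_assoc: "(x \<star> y) \<star> z = x \<star> (y \<star> z)"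
proof -
  have *: "(blade A \<star> blade B) \<star> blade C = blade A \<star> (blade B \<star> blade C)"
    for A B C :: "'a set"
  proof -
    have "sym_diff (sym_diff A B) C = sym_diff A (sym_diff B C)" by blast
    then show ?thesis
      by (simp add: blade_mult cl_mult.scaleR_left cl_mult.scaleR_right blade_sign_left
          blade_sign_right mult_ac)
  qed
  have "(x' \<star> y') \<star> z' = x' \<star> (y' \<star> z')"
    if "x' = (\<Sum>A\<in>UNIV. (x $ A) *\<^sub>R blade A)" "y' = (\<Sum>A\<in>UNIV. (y $ A) *\<^sub>R blade A)"
       "z' = (\<Sum>A\<in>UNIV. (z $ A) *\<^sub>R blade A)" for x' y' z'
    unfolding that
    by (simp add: cl_mult.sum_left cl_mult.sum_right cl_mult.scaleR_left cl_mult.scaleR_right *)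
  from this[OF cl_expand cl_expand cl_expand] show ?thesis .
qed

lemma cl_mult_scalar_left: "cl_scalar s \<star> x = s *\<^sub>R x"
proof -
  have *: "blade {} \<star> x = x"
  proof -
    have "blade {} \<star> (\<Sum>A\<in>UNIV. (x $ A) *\<^sub>R blade A) = (\<Sum>A\<in>UNIV. (x $ A) *\<^sub>R blade A)"
      by (simp add: cl_mult.sum_right cl_mult.scaleR_right blade_mult blade_sign_def)
    then show ?thesis by (simp flip: cl_expand)
  qed
  show ?thesis by (simp add: cl_scalar_def cl_mult.scaleR_left *)
qed

lemma cl_mult_scalar_right: "x \<star> cl_scalar s = s *\<^sub>R x"
proof -
  have *: "x \<star> blade {} = x"
  proof -
    have "(\<Sum>A\<in>UNIV. (x $ A) *\<^sub>R blade A) \<star> blade {} = (\<Sum>A\<in>UNIV. (x $ A) *\<^sub>R blade A)"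
      by (simp add: cl_mult.sum_left cl_mult.scaleR_left blade_mult blade_sign_def)
    then show ?thesis by (simp flip: cl_expand)
  qed
  show ?thesis by (simp add: cl_scalar_def cl_mult.scaleR_right *)
qed

lemma cl_e_square: "cl_e j \<star> cl_e j = cl_scalar (-1)"
  by (simp add: cl_e_def blade_mult blade_sign_prod cl_scalar_def)

lemma cl_e_anticommute: "i \<noteq> j \<Longrightarrow> cl_e i \<star> cl_e j + cl_e j \<star> cl_e i = 0"
  by (cases "i < j") (auto simp: cl_e_def blade_mult blade_sign_prod insert_Diff_if insert_commute)

lemma blade_insert_Max:
  assumes "\<And>a. a \<in> A \<Longrightarrow> a < j"
  shows "blade (insert j A) = blade A \<star> cl_e j"
proof -
  have "j \<notin> A" using assms by blast
  moreover have "blade_sign A {j} = 1"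
    unfolding blade_sign_prod using assms by (force intro: prod.neutral)
  ultimately show ?thesis by (simp add: cl_e_def blade_mult Un_commute)
qed


section \<open>Functions on subsets of Euclidean space\<close>

primrec ck_on :: "nat \<Rightarrow> ('a::euclidean_space \<Rightarrow> 'b::real_normed_vector) \<Rightarrow> 'a set \<Rightarrow> bool" where
  "ck_on 0 f S \<longleftrightarrow> continuous_on S f"
| "ck_on (Suc k) f S \<longleftrightarrow> (\<forall>x\<in>S. f differentiable (at x)) \<and>
     (\<forall>v\<in>Basis. ck_on k (\<lambda>x. frechet_derivative f (at x) v) S)"

definition smooth_boundary :: "'a::euclidean_space set \<Rightarrow> bool"
  where "smooth_boundary S \<longleftrightarrow>
    (\<forall>p\<in>frontier S. \<exists>U (\<rho> :: 'a \<Rightarrow> real). open U \<and> p \<in> U \<and> (\<forall>k. ck_on k \<rho> U) \<and>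
       frechet_derivative \<rho> (at p) \<noteq> (\<lambda>v. 0) \<and> S \<inter> U = {x \<in> U. \<rho> x < 0})"

definition holder_on :: "real \<Rightarrow> 'a::metric_space set \<Rightarrow> ('a \<Rightarrow> real) \<Rightarrow> bool"
  where "holder_on \<mu> S f \<longleftrightarrow> (\<exists>C. \<forall>x\<in>S. \<forall>y\<in>S. \<bar>f x - f y\<bar> \<le> C * dist x y powr \<mu>)"


section \<open>Axially symmetric sets and functions of axial type\<close>

text \<open>A point $x = x_0 + \underline x$ of $R^{n+1}$ is the pair of $x_0$ and $\underline x$.\<close>

type_synonym 'n point = "real \<times> (real ^ 'n)"

definition axially_symmetric :: "'n::finite point set \<Rightarrow> bool"
  where "axially_symmetric \<Omega> \<longleftrightarrow>
    (\<forall>x\<in>\<Omega>. {(fst x, norm (snd x) *\<^sub>R \<omega>) | \<omega>. norm \<omega> = 1} \<subseteq> \<Omega>)"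

definition axial_coord :: "'n::finite point \<Rightarrow> complex"
  where "axial_coord x = Complex (fst x) (norm (snd x))"

text \<open>
  The representation is required for every admissible unit vector; off the axis it is unique,
  on the axis this forces the second component to vanish.
\<close>

definition axial_rep ::
    "'n::{finite,linorder} point set \<Rightarrow> ('n point \<Rightarrow> 'n clifford) \<Rightarrow>
     (real \<Rightarrow> real \<Rightarrow> real) \<Rightarrow> (real \<Rightarrow> real \<Rightarrow> real) \<Rightarrow> bool"
  where "axial_rep S \<phi> A B \<longleftrightarrow>
    (\<forall>x\<in>S. \<forall>\<omega>. norm \<omega> = 1 \<and> snd x = norm (snd x) *\<^sub>R \<omega> \<longrightarrow>
       \<phi> x = cl_scalar (A (fst x) (norm (snd x))) + B (fst x) (norm (snd x)) *\<^sub>R cl_vector \<omega>)"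

definition cauchy_riemann ::
    "('n::{finite,linorder} point \<Rightarrow> 'n clifford) \<Rightarrow> 'n point \<Rightarrow> 'n clifford"
  where "cauchy_riemann \<phi> x =
    frechet_derivative \<phi> (at x) (1, 0) +
    (\<Sum>j\<in>UNIV. cl_e j \<star> frechet_derivative \<phi> (at x) (0, axis j 1))"

text \<open>
  Solutions of the boundary value problem. The equation replaces monogenicity, so $\phi$
  is only required to be of axial type; the boundary values are those of a continuous extension
  to the closure.
\<close>

definition rh_solution ::
    "real \<Rightarrow> 'n::{finite,linorder} point set \<Rightarrow> ('n point \<Rightarrow> real) \<Rightarrow> ('n point \<Rightarrow> 'n clifford) \<Rightarrow> bool"
  where "rh_solution \<alpha> \<Omega> g \<phi> \<longleftrightarrow>
    ck_on 1 \<phi> \<Omega> \<and> continuous_on (closure \<Omega>) \<phi> \<and>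
    (\<forall>x\<in>\<Omega>. cauchy_riemann \<phi> x - \<alpha> *\<^sub>R \<phi> x = 0) \<and>
    (\<exists>A B. axial_rep (closure \<Omega>) \<phi> A B \<and>
           (\<forall>t\<in>frontier \<Omega>. A (fst t) (norm (snd t)) = g t))"


section \<open>The plane problem\<close>

text \<open>Both maps are understood as extended to the closures.\<close>

definition conformal_onto_disk :: "complex set \<Rightarrow> (complex \<Rightarrow> complex) \<Rightarrow> (complex \<Rightarrow> complex) \<Rightarrow> bool"
  where "conformal_onto_disk D \<psi> \<phi> \<longleftrightarrow>
    \<psi> holomorphic_on D \<and> homeomorphism (closure D) (cball 0 1) \<psi> \<phi> \<and>
    \<psi> ` D = ball 0 1 \<and> \<psi> ` frontier D = sphere 0 1"

definition vekua_exponent :: "nat \<Rightarrow> complex set \<Rightarrow> (complex \<Rightarrow> complex) \<Rightarrow> complex \<Rightarrow> complex"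
  where "vekua_exponent n D w z = 1 / of_real pi *
    (LINT \<rho>:D|lborel.
       ((of_nat n - 1) * \<i> / (4 * of_real (Im \<rho>))
        - (of_nat n - 1) * \<i> / (4 * of_real (Im \<rho>)) * (cnj (w \<rho>) / w \<rho>)) / (\<rho> - z))"

text \<open>A single-valued branch on the unit circle of $\arg \lambda_0 + m \arg \gamma$.\<close>

definition arg_branch :: "(complex \<Rightarrow> complex) \<Rightarrow> int \<Rightarrow> (complex \<Rightarrow> real) \<Rightarrow> bool"
  where "arg_branch lam0 m q \<longleftrightarrow> continuous_on (sphere 0 1) q \<and>
    (\<forall>\<gamma>\<in>sphere 0 1. \<exists>k::int. q \<gamma> = Arg (lam0 \<gamma>) + of_int m * Arg \<gamma> + 2 * pi * of_int k)"

text \<open>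
  The values of $\chi$ on the circle are those of its continuous extension from the open disk, where
  it is the Schwarz integral of its imaginary part.
\<close>

definition index_factorization :: "(complex \<Rightarrow> complex) \<Rightarrow> int \<Rightarrow> (complex \<Rightarrow> complex) \<Rightarrow> bool"
  where "index_factorization lam0 m chi \<longleftrightarrow>
    chi holomorphic_on ball 0 1 \<and> continuous_on (cball 0 1) chi \<and>
    arg_branch lam0 m (\<lambda>\<gamma>. Im (chi \<gamma>)) \<and>
    (\<forall>\<gamma>\<in>ball 0 1. chi \<gamma> = 1 / (2 * of_real pi) *
       contour_integral (circlepath 0 1)
         (\<lambda>\<tau>. of_real (Im (chi \<tau>)) * ((\<tau> + \<gamma>) / (\<tau> - \<gamma>)) / \<tau>)) \<and>
    (\<forall>\<gamma>\<in>sphere 0 1. lam0 \<gamma> =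
       of_real (cmod (lam0 \<gamma>)) * \<gamma> powi (- m) * exp (chi \<gamma>) * exp (- of_real (Re (chi \<gamma>))))"

end

theory Submission
  imports Defs
begin

text \<open>
  Restricted to a meridian half-plane, a solution $\phi = A + \underline\omega B$ becomes the complex function
  $w = e^{-\alpha x_0}(A + \mathrm{i} B)$, and the Clifford equation becomes the Vekua equation
  $\partial_{\bar z} w = -\frac{(n-1)\mathrm{i}}{4\eta}(w - \bar w)$ (lemma vekua_equation). A smooth axially symmetric
  domain that avoids the axis has no boundary points on the axis either (lemma smooth_boundary_axis), so its meridian
  section $D$ has compact closure in the open upper half-plane and the coefficient is bounded there.
  
  Hence $\partial_{\bar z} w = - f w$ with the bounded density
  $f = \frac{(n-1)\mathrm{i}}{4\eta}(1 - \bar w/w)$, and $\nu$ is $1/\pi$ times the Cauchy transform of $f$. Such a transform is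
  continuous on the whole plane (lemma continuous_on_cauchy_transform) and satisfies
  $\partial_{\bar z} \nu = -f$ wherever $f$ is differentiable (theorem cauchy_transform_has_derivative), that is, off
  the zeros of $w$. So $\Psi = w e^{-\nu}$ is complex differentiable off the zeros of $w$; at a zero it is so because
  $w$ is, and $e^{-\nu}$ is continuous (theorem similarity_principle). Thus $\Psi$ is holomorphic in $D$ and
  continuous up to the boundary.
  
  Transplanted to the unit disk, $e^{\nu}$ has the continuous logarithm $\nu$, so every factorization of it has
  index $m = 0$ (lemma index_of_continuous_argument); negative indices do not occur. The boundary condition
  prescribes $\mathrm{Re}(\Psi e^{\nu})$, hence the real part of $\Psi e^{\chi}$, and the Schwarz formula
  (theorem schwarz_formula_disk) recovers this holomorphic function up to the imaginary constant $c_0$.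
\<close>

section \<open>The Cauchy transform of a bounded density\<close>

lemma norm_integral_le_integral_AE:
  fixes f :: "'a \<Rightarrow> 'b::{banach, second_countable_topology}"
  assumes "integrable M f" "integrable M g" "AE x in M. norm (f x) \<le> g x"
  shows "norm (integral\<^sup>L M f) \<le> (LINT x|M. g x)"
  by (rule order_trans[OF integral_norm_bound integral_mono_AE]) (use assms in auto)

text \<open>
  The singularity of $1/|u - z|$ is integrable in the plane: on the annulus
  $e\,2^{-k-1} \le |u - z| < e\,2^{-k}$ the kernel is at most $2^{k+1}/e$, while the area is at most
  $\pi e^2 4^{-k}$, which gives a geometric series with sum $4 \pi e$. The linear dependence on $e$
  is what makes the truncation of the kernel uniform below.
\<close>
lemma nn_integral_inverse_distance_ball:
  fixes z :: complex
  assumes e: "0 < e"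
  shows "(\<integral>\<^sup>+u. ennreal (indicator (ball z e) u / norm (u - z)) \<partial>lborel) \<le> ennreal (4 * pi * e)"
proof -
  have pt: "ennreal (indicator (ball z e) u / norm (u - z))
      \<le> (\<Sum>k. ennreal (2 * 2 ^ k / e) * indicator (ball z (e / 2 ^ k)) u)" for u :: complex
  proof (cases "u \<in> ball z e \<and> u \<noteq> z")
    case True
    define d where "d = norm (u - z)"
    have d: "0 < d" "d < e" using True by (auto simp: d_def dist_norm norm_minus_commute)
    define P where "P k \<longleftrightarrow> e / 2 ^ Suc k \<le> d" for k
    have "\<exists>k. (1/2) ^ k < d / e"
      using d e real_arch_pow_inv[of "d/e" "1/2"] by auto
    then obtain k where "(1/2) ^ k < d / e" by blast
    then have "P k" using d e by (simp add: P_def field_simps)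
    define k0 where "k0 = (LEAST k. P k)"
    have "P k0" unfolding k0_def using \<open>P k\<close> by (rule LeastI)
    \<comment> \<open>minimality of $k_0$ puts $u$ inside the ball of radius $e / 2^{k_0}$\<close>
    have lt: "d < e / 2 ^ k0"
    proof (cases k0)
      case 0 then show ?thesis using d by simp
    next
      case (Suc j)
      then have "\<not> P j" unfolding k0_def using not_less_Least[of j P] by simp
      then show ?thesis by (simp add: P_def Suc)
    qed
    have "ennreal (indicator (ball z e) u / norm (u - z)) = ennreal (1 / d)"
      using True by (simp add: d_def)
    also have "\<dots> \<le> ennreal (2 * 2 ^ k0 / e)"
      using \<open>P k0\<close> d e by (intro ennreal_leI) (simp add: P_def field_simps)
    also have "\<dots> = ennreal (2 * 2 ^ k0 / e) * indicator (ball z (e / 2 ^ k0)) u"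
      using lt by (simp add: d_def dist_norm norm_minus_commute)
    also have "\<dots> = sum (\<lambda>k. ennreal (2 * 2 ^ k / e) * indicator (ball z (e / 2 ^ k)) u) {k0}"
      by (simp only: sum.insert finite.emptyI empty_iff not_False_eq_True sum.empty add_0_right)
    also have "\<dots> \<le> (\<Sum>k. ennreal (2 * 2 ^ k / e) * indicator (ball z (e / 2 ^ k)) u)"
      by (rule sum_le_suminf) auto
    finally show ?thesis .
  qed auto
  have "(\<integral>\<^sup>+u. ennreal (indicator (ball z e) u / norm (u - z)) \<partial>lborel)
      \<le> (\<integral>\<^sup>+u. (\<Sum>k. ennreal (2 * 2 ^ k / e) * indicator (ball z (e / 2 ^ k)) u) \<partial>lborel)"
    by (rule nn_integral_mono) (rule pt)
  also have "\<dots> = (\<Sum>k. \<integral>\<^sup>+u. ennreal (2 * 2 ^ k / e) * indicator (ball z (e / 2 ^ k)) u \<partial>lborel)"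
    by (intro nn_integral_suminf borel_measurable_times_ennreal borel_measurable_indicator) auto
  also have "\<dots> = (\<Sum>k. ennreal (2 * pi * e * (1 / 2) ^ k))"
  proof (rule arg_cong[where f = suminf], rule ext)
    fix k :: nat
    have "(\<integral>\<^sup>+u. ennreal (2 * 2 ^ k / e) * indicator (ball z (e / 2 ^ k)) u \<partial>lborel)
        = ennreal (2 * 2 ^ k / e) * emeasure lborel (ball z (e / 2 ^ k))"
      by (rule nn_integral_cmult_indicator) simp
    also have "\<dots> = ennreal (2 * 2 ^ k / e) * ennreal (pi * (e / 2 ^ k)\<^sup>2)"
      using e by (simp add: emeasure_ball eval_unit_ball_vol)
    also have "\<dots> = ennreal (2 * pi * e * (1 / 2) ^ k)"
      using e by (subst ennreal_mult[symmetric]) (auto simp: field_simps power2_eq_square)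
    finally show "(\<integral>\<^sup>+u. ennreal (2 * 2 ^ k / e) * indicator (ball z (e / 2 ^ k)) u \<partial>lborel)
        = ennreal (2 * pi * e * (1 / 2) ^ k)" .
  qed
  also have "\<dots> = ennreal (4 * pi * e)"
  proof -
    have "(\<lambda>k. 2 * pi * e * (1 / 2) ^ k) sums (2 * pi * e * (1 / (1 - 1 / 2)))"
      by (intro sums_mult geometric_sums) simp
    then have "(\<lambda>k. 2 * pi * e * (1 / 2) ^ k) sums (4 * pi * e)" by (simp add: mult_ac)
    then show ?thesis using e by (intro suminf_ennreal_eq) auto
  qed
  finally show ?thesis .
qed

lemma
  fixes z :: complex
  assumes e: "0 < e"
  shows integrable_inverse_distance_ball: "integrable lborel (\<lambda>u. indicator (ball z e) u / norm (u - z) :: real)"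
    and integral_inverse_distance_ball: "(LINT u|lborel. indicator (ball z e) u / norm (u - z)) \<le> 4 * pi * e"
proof -
  have [measurable]: "(\<lambda>u. indicator (ball z e) u / norm (u - z) :: real) \<in> borel_measurable borel"
    by (intro borel_measurable_divide borel_measurable_indicator) auto
  show i: "integrable lborel (\<lambda>u. indicator (ball z e) u / norm (u - z) :: real)"
    using nn_integral_inverse_distance_ball[OF e, of z]
    by (intro integrableI_nonneg) (auto simp: less_top[symmetric] top_unique)
  have "ennreal (LINT u|lborel. indicator (ball z e) u / norm (u - z)) \<le> ennreal (4 * pi * e)"
    using nn_integral_inverse_distance_ball[OF e, of z] i by (subst nn_integral_eq_integral[symmetric]) auto
  then show "(LINT u|lborel. indicator (ball z e) u / norm (u - z)) \<le> 4 * pi * e"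
    using e by (subst (asm) ennreal_le_iff) auto
qed

definition bounded_density :: "(complex \<Rightarrow> complex) \<Rightarrow> bool"
  where "bounded_density f \<longleftrightarrow> f \<in> borel_measurable borel \<and>
    (\<exists>M. \<forall>\<rho>. norm (f \<rho>) \<le> M) \<and> (\<exists>R. \<forall>\<rho>. R \<le> norm \<rho> \<longrightarrow> f \<rho> = 0)"

definition cauchy_transform :: "(complex \<Rightarrow> complex) \<Rightarrow> complex \<Rightarrow> complex"
  where "cauchy_transform f z = (LINT \<rho>|lborel. f \<rho> / (\<rho> - z))"

lemma bounded_densityE:
  assumes "bounded_density f"
  obtains M R where "f \<in> borel_measurable borel" "0 < M" "0 < R"
    "\<And>\<rho>. norm (f \<rho>) \<le> M * indicator (ball 0 R) \<rho>"
proof -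
  obtain M R where m: "f \<in> borel_measurable borel" "\<And>\<rho>. norm (f \<rho>) \<le> M" "\<And>\<rho>. R \<le> norm \<rho> \<Longrightarrow> f \<rho> = 0"
    using assms by (auto simp: bounded_density_def)
  have "norm (f \<rho>) \<le> max 1 M * indicator (ball 0 (max 1 R)) \<rho>" for \<rho>
    using m(2)[of \<rho>] m(3)[of \<rho>] by (auto simp: indicator_def)
  with m(1) show thesis by (intro that[of "max 1 M" "max 1 R"]) auto
qed

lemma bounded_density_diff:
  assumes "bounded_density f" "bounded_density g"
  shows "bounded_density (\<lambda>\<rho>. f \<rho> - g \<rho>)"
proof -
  obtain M R where f: "f \<in> borel_measurable borel" "\<And>\<rho>. norm (f \<rho>) \<le> M" "\<And>\<rho>. R \<le> norm \<rho> \<Longrightarrow> f \<rho> = 0"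
    using assms(1) by (auto simp: bounded_density_def)
  obtain M' R' where g: "g \<in> borel_measurable borel" "\<And>\<rho>. norm (g \<rho>) \<le> M'" "\<And>\<rho>. R' \<le> norm \<rho> \<Longrightarrow> g \<rho> = 0"
    using assms(2) by (auto simp: bounded_density_def)
  have "norm (f \<rho> - g \<rho>) \<le> M + M'" for \<rho>
    using f(2) g(2) norm_triangle_ineq4 by (meson add_mono order_trans)
  moreover have "max R R' \<le> norm \<rho> \<Longrightarrow> f \<rho> - g \<rho> = 0" for \<rho>
    using f(3) g(3) by simp
  ultimately show ?thesis unfolding bounded_density_def using f(1) g(1)
    by (intro conjI exI[of _ "M + M'"] exI[of _ "max R R'"]) auto
qed

lemma bounded_density_cmult:
  assumes "bounded_density f"
  shows "bounded_density (\<lambda>\<rho>. a * f \<rho>)"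
proof -
  obtain M R where f: "f \<in> borel_measurable borel" "\<And>\<rho>. norm (f \<rho>) \<le> M" "\<And>\<rho>. R \<le> norm \<rho> \<Longrightarrow> f \<rho> = 0"
    using assms(1) by (auto simp: bounded_density_def)
  have "norm (a * f \<rho>) \<le> norm a * M" for \<rho>
    using f(2)[of \<rho>] by (simp add: norm_mult mult_left_mono)
  then show ?thesis unfolding bounded_density_def using f(1,3) by auto
qed

lemma integrable_indicator_ball: "integrable lborel (indicator (ball (z::complex) R) :: complex \<Rightarrow> real)"
  using emeasure_lborel_ball_finite[of z R] by (intro integrable_real_indicator) auto

lemma bounded_density_integrable:
  assumes "bounded_density f" shows "integrable lborel f"
proof -
  obtain M R where f: "f \<in> borel_measurable borel" "\<And>\<rho>. norm (f \<rho>) \<le> M * indicator (ball 0 R) \<rho>"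
    using bounded_densityE[OF assms] by metis
  show ?thesis
    by (rule Bochner_Integration.integrable_bound[OF integrable_mult_right[OF integrable_indicator_ball[of 0 R], of M]])
       (use f order_trans[OF f(2) abs_ge_self] in auto)
qed

lemma cauchy_transform_integrable:
  assumes "bounded_density f"
  shows "integrable lborel (\<lambda>\<rho>. f \<rho> / (\<rho> - z))"
proof -
  obtain M R where f: "f \<in> borel_measurable borel" "0 < M" "\<And>\<rho>. norm (f \<rho>) \<le> M * indicator (ball 0 R) \<rho>"
    using bounded_densityE[OF assms] by metis
  have "integrable lborel (\<lambda>\<rho>. M * (indicator (ball z 1) \<rho> / norm (\<rho> - z) + indicator (ball 0 R) \<rho>) :: real)"
    by (intro integrable_mult_right Bochner_Integration.integrable_add integrable_inverse_distance_ball integrable_indicator_ball) simp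
  then show ?thesis
  proof (rule Bochner_Integration.integrable_bound)
    show "AE \<rho> in lborel. norm (f \<rho> / (\<rho> - z))
       \<le> norm (M * (indicator (ball z 1) \<rho> / norm (\<rho> - z) + indicator (ball 0 R) \<rho>) :: real)"
    proof (rule AE_I2)
      fix \<rho>
      have *: "norm (f \<rho>) \<le> M" using f(3)[of \<rho>] f(2) by (cases "\<rho> \<in> ball 0 R") auto
      have "norm (f \<rho> / (\<rho> - z)) \<le> M * (indicator (ball z 1) \<rho> / norm (\<rho> - z) + indicator (ball 0 R) \<rho>)"
      proof (cases "\<rho> \<in> ball z 1")
        case True
        have "norm (f \<rho> / (\<rho> - z)) \<le> M / norm (\<rho> - z)"
          using * by (simp add: norm_divide divide_right_mono)
        also have "\<dots> \<le> M * (indicator (ball z 1) \<rho> / norm (\<rho> - z) + indicator (ball 0 R) \<rho>)"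
          using True f(2) by (simp add: distrib_left)
        finally show ?thesis .
      next
        case False
        then have "norm (\<rho> - z) \<ge> 1" by (simp add: dist_norm norm_minus_commute)
        then have "norm (f \<rho> / (\<rho> - z)) \<le> norm (f \<rho>)"
          by (simp add: norm_divide divide_le_eq mult_le_cancel_left1) 
        then show ?thesis using f(3)[of \<rho>] False by simp
      qed
      then show "norm (f \<rho> / (\<rho> - z))
       \<le> norm (M * (indicator (ball z 1) \<rho> / norm (\<rho> - z) + indicator (ball 0 R) \<rho>) :: real)"
        by simp
    qed
  qed (use f in auto)
qed

text \<open>
  Replacing the kernel $1/u = \bar u/|u|^2$ by $\bar u/\max(|u|,e)^2$, which is continuous and bounded,
  changes the transform by at most $4 \pi M e$ at every point. The truncated transforms are
  continuous by dominated convergence, and so is their uniform limit.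
\<close>
lemma continuous_on_cauchy_transform:
  assumes "bounded_density f"
  shows "continuous_on UNIV (cauchy_transform f)"
proof -
  obtain M R where f: "f \<in> borel_measurable borel" "0 < M" "0 < R" "\<And>\<rho>. norm (f \<rho>) \<le> M * indicator (ball 0 R) \<rho>"
    using bounded_densityE[OF assms] by metis
  have [measurable]: "f \<in> borel_measurable borel" by fact
  have fM: "norm (f \<rho>) \<le> M" for \<rho> using f(4)[of \<rho>] f(2) by (cases "\<rho> \<in> ball 0 R") auto
  define k :: "real \<Rightarrow> complex \<Rightarrow> complex" where "k e u = cnj u / of_real ((max (norm u) e)\<^sup>2)" for e u
  have k_bound: "norm (k e u) \<le> 1 / e" if "0 < e" for e u
  proof -
    have "norm (k e u) = norm u / (max (norm u) e)\<^sup>2"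
      by (simp add: k_def norm_divide norm_power)
    also have "\<dots> \<le> max (norm u) e / (max (norm u) e)\<^sup>2"
      by (intro divide_right_mono) auto
    also have "\<dots> = 1 / max (norm u) e" using that by (simp add: power2_eq_square)
    also have "\<dots> \<le> 1 / e" using that by (intro divide_left_mono) auto
    finally show ?thesis .
  qed
  have k_cont: "continuous_on UNIV (k e)" if "0 < e" for e
    unfolding k_def using that by (intro continuous_intros) auto
  have k_meas: "k e \<in> borel_measurable borel" if "0 < e" for e
    using k_cont[OF that] by (rule borel_measurable_continuous_onI)
  have k_diff: "norm (1 / u - k e u) \<le> indicator (ball 0 e) u / norm u" if "0 < e" for e u
  proof (cases "norm u < e")
    case True
    show ?thesis
    proof (cases "u = 0")
      case False
      have "1 / u - k e u = of_real (1 - (norm u)\<^sup>2 / e\<^sup>2) / u"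
        using True False complex_norm_square[of u] that
        by (simp add: k_def field_simps power2_eq_square)
      moreover have "\<bar>1 - (norm u)\<^sup>2 / e\<^sup>2\<bar> \<le> 1"
        using True that power_mono[of "norm u" e 2] by (simp add: abs_le_iff field_simps)
      ultimately show ?thesis using True
        by (simp add: norm_divide divide_right_mono del: of_real_diff of_real_divide of_real_power)
    qed (simp add: k_def)
  next
    case False
    then have "u \<noteq> 0" using that by auto
    then have "k e u = 1 / u"
      using False complex_norm_square[of u] by (simp add: k_def field_simps max_def power2_eq_square)
    then show ?thesis by simp
  qed
  define T where "T e z = (LINT \<rho>|lborel. f \<rho> * k e (\<rho> - z))" for e z
  have T_dom: "integrable lborel (\<lambda>\<rho>::complex. M * indicator (ball 0 R) \<rho> * (1 / e) :: real)" for e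
    by (intro integrable_mult_left integrable_mult_right integrable_indicator_ball)
  have T_bd: "norm (f \<rho> * k e (\<rho> - z)) \<le> M * indicator (ball 0 R) \<rho> * (1 / e)" if "0 < e" for e \<rho> z
    unfolding norm_mult by (rule mult_mono[OF f(4) k_bound[OF that]]) (use f in auto)
  have k_meas2: "(\<lambda>\<rho>. k e (\<rho> - z)) \<in> borel_measurable borel" if "0 < e" for e z
    using measurable_compose[OF _ k_meas[OF that], of "\<lambda>\<rho>. \<rho> - z"] by simp
  have T_cont: "continuous_on UNIV (T e)" if e: "0 < e" for e
    unfolding continuous_on_sequentially
  proof (intro ballI allI impI, elim conjE)
    fix z :: complex and x assume x: "x \<longlonglongrightarrow> z"
    show "(T e \<circ> x) \<longlonglongrightarrow> T e z"
      unfolding T_def comp_def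
    proof (rule integral_dominated_convergence[where w = "\<lambda>\<rho>. M * indicator (ball 0 R) \<rho> * (1 / e)"])
      show "AE \<rho> in lborel. (\<lambda>i. f \<rho> * k e (\<rho> - x i)) \<longlonglongrightarrow> f \<rho> * k e (\<rho> - z)"
      proof (rule AE_I2)
        fix \<rho>
        have "isCont (k e) (\<rho> - z)" using k_cont[OF e] by (simp add: continuous_on_eq_continuous_at)
        then show "(\<lambda>i. f \<rho> * k e (\<rho> - x i)) \<longlonglongrightarrow> f \<rho> * k e (\<rho> - z)"
          by (intro tendsto_intros isCont_tendsto_compose[where g = "k e"] x)
      qed
      show "AE \<rho> in lborel. norm (f \<rho> * k e (\<rho> - x i)) \<le> M * indicator (ball 0 R) \<rho> * (1 / e)" for i
        using T_bd[OF e] by auto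
    qed (use k_meas2[OF e] T_dom f(1) in auto)
  qed
  have close: "norm (T e z - cauchy_transform f z) \<le> M * (4 * pi * e)" if e: "0 < e" for e z
  proof -
    have iT: "integrable lborel (\<lambda>\<rho>. f \<rho> * k e (\<rho> - z))"
      by (rule Bochner_Integration.integrable_bound[OF T_dom[of e]])
         (use k_meas2[OF e] f(1) order_trans[OF T_bd[OF e] abs_ge_self] in auto)
    have "cauchy_transform f z - T e z = (LINT \<rho>|lborel. f \<rho> / (\<rho> - z) - f \<rho> * k e (\<rho> - z))"
      unfolding cauchy_transform_def T_def
      by (rule Bochner_Integration.integral_diff[symmetric, OF cauchy_transform_integrable[OF assms] iT])
    also have "norm \<dots> \<le> (LINT \<rho>|lborel. M * (indicator (ball z e) \<rho> / norm (\<rho> - z)))"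
    proof (rule norm_integral_le_integral_AE[OF _ _ AE_I2])
      fix \<rho>
      have "norm (f \<rho> / (\<rho> - z) - f \<rho> * k e (\<rho> - z)) = norm (f \<rho>) * norm (1 / (\<rho> - z) - k e (\<rho> - z))"
        by (simp add: norm_mult[symmetric] right_diff_distrib)
      also have "\<dots> \<le> M * (indicator (ball 0 e) (\<rho> - z) / norm (\<rho> - z))"
        by (rule mult_mono[OF fM k_diff[OF e]]) (use f in auto)
      also have "indicator (ball 0 e) (\<rho> - z) = (indicator (ball z e) \<rho> :: real)"
        by (simp add: indicator_def dist_norm norm_minus_commute)
      finally show "norm (f \<rho> / (\<rho> - z) - f \<rho> * k e (\<rho> - z)) \<le> M * (indicator (ball z e) \<rho> / norm (\<rho> - z))" .
    qed (intro Bochner_Integration.integrable_diff integrable_mult_right cauchy_transform_integrable assms iT integrable_inverse_distance_ball e)+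
    also have "\<dots> \<le> M * (4 * pi * e)"
      unfolding integral_mult_right_zero
      using integral_inverse_distance_ball[OF e, of z] f(2) by (intro mult_left_mono) auto
    finally show ?thesis by (simp add: norm_minus_commute)
  qed
  have "uniform_limit UNIV T (cauchy_transform f) (at_right 0)"
    unfolding uniform_limit_iff
  proof (intro allI impI)
    fix d :: real assume d: "0 < d"
    have "\<forall>\<^sub>F e in at_right 0. e \<in> {0<..<d / (M * 4 * pi)}"
      by (rule eventually_at_right_real) (use d f in simp)
    then show "\<forall>\<^sub>F e in at_right 0. \<forall>z\<in>UNIV. dist (T e z) (cauchy_transform f z) < d"
    proof eventually_elim
      case (elim e)
      then have "M * (4 * pi * e) < d" using f(2) by (simp add: field_simps)
      then show ?case using close[of e] elim by (auto simp: dist_norm intro: le_less_trans)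
    qed
  qed
  moreover have "\<forall>\<^sub>F e in at_right 0. continuous_on UNIV (T e)"
    using eventually_at_right_less by eventually_elim (rule T_cont)
  ultimately show ?thesis by (intro uniform_limit_theorem) auto
qed

text \<open>
  Second-order Taylor estimate of $s \mapsto \max(0, 1 - s)^2$, whose derivative
  $-2\max(0, 1 - s)$ is Lipschitz with constant $2$.
\<close>
lemma max_square_taylor:
  fixes s t :: real
  shows "\<bar>(max 0 (1 - t))\<^sup>2 - (max 0 (1 - s))\<^sup>2 + 2 * max 0 (1 - s) * (t - s)\<bar> \<le> (t - s)\<^sup>2"
proof -
  define a where "a = max 0 (1 - s)"
  define b where "b = max 0 (1 - t)"
  consider "s \<le> 1" "t \<le> 1" | "s \<le> 1" "1 < t" | "1 < s" by linarith
  then have "\<bar>b\<^sup>2 - a\<^sup>2 + 2 * a * (t - s)\<bar> \<le> (t - s)\<^sup>2"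
  proof cases
    case 1
    then have "t - s = a - b" by (simp add: a_def b_def)
    then have "b\<^sup>2 - a\<^sup>2 + 2 * a * (t - s) = (t - s)\<^sup>2"
      by (simp only:) (simp add: power2_eq_square algebra_simps)
    then show ?thesis by simp
  next
    case 2
    then have b: "b = 0" and a: "0 \<le> a" "a \<le> t - s" by (auto simp: a_def b_def)
    define d where "d = t - s"
    have "0 \<le> (d - a)\<^sup>2" by simp
    then have "2 * (a * d) \<le> a * a + d * d" by (simp add: power2_eq_square algebra_simps)
    moreover have "a * a \<le> a * d" using a by (simp add: d_def mult_left_mono)
    moreover have "0 \<le> d * d" by simp
    moreover have "0 \<le> a * a" by simp
    moreover have "b\<^sup>2 - a\<^sup>2 + 2 * a * (t - s) = 2 * (a * d) - a * a" "(t - s)\<^sup>2 = d * d"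
      using b by (simp_all add: d_def power2_eq_square)
    ultimately show ?thesis by linarith
  next
    case 3
    then have "a = 0" "0 \<le> b" "b \<le> \<bar>t - s\<bar>" by (auto simp: a_def b_def)
    then show ?thesis using power_mono[of b "\<bar>t - s\<bar>" 2] by simp
  qed
  then show ?thesis by (simp add: a_def b_def)
qed

text \<open>
  The volume under the cap, by slicing at height $t$: the slice is a disk of area $\pi(1 - t)$.
\<close>
lemma integral_paraboloid_cap: "(LINT u|lborel. max 0 (1 - (norm (u::complex))\<^sup>2)) = pi / 2"
proof -
  have m: "(\<lambda>u. max 0 (1 - (norm (u::complex))\<^sup>2)) \<in> borel_measurable borel" by measurable
  have "(\<integral>\<^sup>+ u. ennreal (max 0 (1 - (norm (u::complex))\<^sup>2)) \<partial>lborel)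
     = (\<integral>\<^sup>+ u. (\<integral>\<^sup>+ t. indicator {(u, t). 0 < t \<and> t < 1 - (norm (u::complex))\<^sup>2} (u, t) \<partial>lborel) \<partial>lborel)"
  proof (rule nn_integral_cong)
    fix u :: complex
    have "(\<integral>\<^sup>+ t. indicator {(u, t). 0 < t \<and> t < 1 - (norm (u::complex))\<^sup>2} (u, t) \<partial>lborel)
       = (\<integral>\<^sup>+ t. indicator {0<..<1 - (norm u)\<^sup>2} t \<partial>lborel)"
      by (rule nn_integral_cong) (auto simp: indicator_def)
    also have "\<dots> = ennreal (max 0 (1 - (norm (u::complex))\<^sup>2))"
      by (cases "0 \<le> 1 - (norm u)\<^sup>2") (auto simp: max_def)
    finally show "ennreal (max 0 (1 - (norm (u::complex))\<^sup>2)) =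
       (\<integral>\<^sup>+ t. indicator {(u, t). 0 < t \<and> t < 1 - (norm (u::complex))\<^sup>2} (u, t) \<partial>lborel)" by simp
  qed
  also have "\<dots> = (\<integral>\<^sup>+ t. (\<integral>\<^sup>+ u. indicator {(u, t). 0 < t \<and> t < 1 - (norm (u::complex))\<^sup>2} (u, t) \<partial>lborel) \<partial>lborel)"
    by (rule lborel_pair.Fubini'[symmetric]) (simp add: split_beta')
  also have "\<dots> = (\<integral>\<^sup>+ t. ennreal (pi * (1 - t)) * indicator {0..1} t \<partial>lborel)"
  proof (rule nn_integral_cong_AE)
    have "AE t in lborel. t \<noteq> (0::real)" by (rule AE_lborel_singleton)
    then show "AE t in lborel. (\<integral>\<^sup>+ u. indicator {(u, t). 0 < t \<and> t < 1 - (norm (u::complex))\<^sup>2} (u, t) \<partial>lborel)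
        = ennreal (pi * (1 - t)) * indicator {0..1} t"
    proof eventually_elim
      case (elim t)
      show ?case
      proof (cases "0 < t \<and> t < 1")
        case True
        have "(norm u)\<^sup>2 < 1 - t \<longleftrightarrow> norm u < sqrt (1 - t)" for u :: complex
          by (metis abs_norm_cancel real_sqrt_abs real_sqrt_less_iff)
        then have "t < 1 - (norm u)\<^sup>2 \<longleftrightarrow> norm u < sqrt (1 - t)" for u :: complex
          by (metis add.commute less_diff_eq)
        then have "(\<integral>\<^sup>+ u. indicator {(u, t). 0 < t \<and> t < 1 - (norm (u::complex))\<^sup>2} (u, t) \<partial>lborel)
           = (\<integral>\<^sup>+ u. indicator (ball (0::complex) (sqrt (1 - t))) u \<partial>lborel)"
          using True by (intro nn_integral_cong) (auto simp: indicator_def)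
        then show ?thesis using True by (simp add: emeasure_ball eval_unit_ball_vol)
      next
        case False
        then have "\<not> (0 < t \<and> t < 1 - (norm (u::complex))\<^sup>2)" for u
          by (smt (verit) zero_le_power2)
        moreover have "ennreal (pi * (1 - t)) * indicator {0..1} t = 0"
          using False elim by (cases "t = 1") auto
        ultimately show ?thesis by (simp only: indicator_def mem_Collect_eq prod.case if_False) simp
      qed
    qed
  qed
  also have "\<dots> = ennreal (pi * (1 - 1 / 2) - pi * (0 - 0))"
    by (rule nn_integral_FTC_Icc[where F = "\<lambda>t. pi * (t - t\<^sup>2 / 2)", THEN trans])
       (auto intro!: derivative_eq_intros simp: algebra_simps)
  finally have "(\<integral>\<^sup>+ u. ennreal (max 0 (1 - (norm (u::complex))\<^sup>2)) \<partial>lborel) = ennreal (pi / 2)" by simp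
  then show ?thesis using m by (subst integral_eq_nn_integral) auto
qed

lemma lborel_integral_translation:
  fixes f :: "complex \<Rightarrow> complex"
  assumes "f \<in> borel_measurable borel"
  shows "(LINT x|lborel. f (t + x)) = (LINT x|lborel. f x)"
proof -
  have "(LINT x|lborel. f x) = (LINT x|distr lborel borel ((+) t). f x)" by (simp add: lborel_distr_plus)
  also have "\<dots> = (LINT x|lborel. f (t + x))" using assms by (subst integral_distr) auto
  finally show ?thesis by simp
qed

text \<open>
  A compactly supported $C^1$ model density with value $1$ at the origin. It is a function of $|u|^2$,
  so that $\partial_{\bar u}$ of it is $u$ times a bounded function, which cancels the
  Cauchy kernel.
\<close>
definition bump :: "complex \<Rightarrow> complex"
  where "bump u = of_real ((max 0 (1 - (norm u)\<^sup>2))\<^sup>2)"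

lemma norm_ge_1_bump: "1 \<le> norm u \<Longrightarrow> 1 - (norm (u::complex))\<^sup>2 \<le> 0"
  by (simp add: one_le_power)

lemma bounded_density_bump: "bounded_density (\<lambda>\<rho>. bump (\<rho> - c))"
proof -
  have "(\<lambda>\<rho>. bump (\<rho> - c)) \<in> borel_measurable borel" unfolding bump_def by measurable
  moreover have "norm (bump u) \<le> 1" for u
    by (auto simp: bump_def norm_power intro!: power_le_one)
  moreover have "bump (\<rho> - c) = 0" if "1 + norm c \<le> norm \<rho>" for \<rho>
  proof -
    have "1 \<le> norm (\<rho> - c)" using that norm_triangle_ineq2[of \<rho> c] by linarith
    then show ?thesis using norm_ge_1_bump[of "\<rho> - c"] by (simp add: bump_def)
  qed
  ultimately show ?thesis unfolding bounded_density_def by blast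
qed

lemma bump_flat: 
  assumes "norm u \<le> 1"
  shows "norm (bump u - 1) \<le> 2 * norm u"
proof -
  define s where "s = (norm u)\<^sup>2"
  have s: "0 \<le> s" "s \<le> norm u" using assms by (auto simp: s_def power2_eq_square mult_left_le)
  have "bump u - 1 = of_real ((1 - s)\<^sup>2 - 1)"
    using s assms by (simp add: bump_def s_def[symmetric] max_def)
  moreover have "\<bar>(1 - s)\<^sup>2 - 1\<bar> \<le> 2 * s"
    using s assms mult_mono[of s 1 s 1] by (simp add: power2_eq_square algebra_simps abs_le_iff) (smt (verit) mult_left_le)
  ultimately show ?thesis using s by (simp del: of_real_diff of_real_power)
qed

lemma bump_taylor:
  fixes u v :: complex
  assumes v: "norm v \<le> 1"
  shows "norm (bump (u + v) - bump u + of_real (2 * max 0 (1 - (norm u)\<^sup>2)) * (v * cnj u + cnj v * u))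
    \<le> 27 * (norm v)\<^sup>2 * indicator (ball 0 3) u"
proof (cases "norm u \<le> 2")
  case True
  define s t where "s = (norm u)\<^sup>2" and "t = (norm (u + v))\<^sup>2"
  define a where "a = max 0 (1 - s)"
  have a: "0 \<le> a" "a \<le> 1" by (auto simp: a_def s_def)
  have ts: "t - s = 2 * Re (v * cnj u) + (norm v)\<^sup>2"
    by (simp add: s_def t_def cmod_power2) (simp add: power2_eq_square algebra_simps)
  have re: "v * cnj u + cnj v * u = of_real (2 * Re (v * cnj u))"
    by (simp add: complex_eq_iff)
  have "bump (u + v) - bump u + of_real (2 * max 0 (1 - (norm u)\<^sup>2)) * (v * cnj u + cnj v * u)
     = of_real (((max 0 (1 - t))\<^sup>2 - (max 0 (1 - s))\<^sup>2 + 2 * a * (t - s)) - 2 * a * (norm v)\<^sup>2)"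
    unfolding re ts by (simp add: bump_def s_def t_def a_def algebra_simps)
  also have "norm \<dots> \<le> (t - s)\<^sup>2 + 2 * a * (norm v)\<^sup>2"
    unfolding norm_of_real a_def using max_square_taylor[of t s] a(1)[unfolded a_def]
    by (smt (verit) mult_nonneg_nonneg zero_le_power2)
  also have "\<dots> \<le> (5 * norm v)\<^sup>2 + 2 * (norm v)\<^sup>2"
  proof (rule add_mono)
    have "\<bar>Re (v * cnj u)\<bar> \<le> norm v * norm u"
      using abs_Re_le_cmod[of "v * cnj u"] by (simp add: norm_mult)
    also have "\<dots> \<le> norm v * 2" using True by (intro mult_left_mono) auto
    finally have "\<bar>t - s\<bar> \<le> 5 * norm v"
      unfolding ts using v mult_left_le[of "norm v" "norm v"] norm_ge_zero[of v]
      by (smt (verit) power2_eq_square zero_le_power2)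
    then show "(t - s)\<^sup>2 \<le> (5 * norm v)\<^sup>2" by (metis abs_ge_zero power2_abs power_mono)
    show "2 * a * (norm v)\<^sup>2 \<le> 2 * (norm v)\<^sup>2" using a by (intro mult_right_mono) auto
  qed
  also have "\<dots> = 27 * (norm v)\<^sup>2 * indicator (ball 0 3) u" using True by (simp add: power_mult_distrib)
  finally show ?thesis .
next
  case False
  then have "1 \<le> norm u" "1 \<le> norm (u + v)"
    using v norm_triangle_ineq2[of u "- v"] by auto
  then have "bump u = 0" "bump (u + v) = 0" "max 0 (1 - (norm u)\<^sup>2) = 0"
    using norm_ge_1_bump[of u] norm_ge_1_bump[of "u + v"] by (auto simp: bump_def)
  then show ?thesis by simp
qed

text \<open>
  With $k(u)$ for the derivative of $s \mapsto \max(0,1-s)^2$ at $s = |u|^2$, the first-order increment of the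
  bump at $u$ in direction $v$ is $k(u)\,(v \bar u + \bar v u)$. Moving the evaluation point into the density and
  integrating this against $1/u$, the part linear in $\bar v$ has the nonsingular coefficient
  $\int k(u)\,du = -\pi$.
\<close>
lemma cauchy_transform_bump:
  "\<exists>p. (cauchy_transform (\<lambda>\<rho>. bump (\<rho> - c)) has_derivative (\<lambda>h. p * h - of_real pi * cnj h)) (at c)"
proof -
  define k :: "complex \<Rightarrow> complex" where "k u = - of_real (2 * max 0 (1 - (norm u)\<^sup>2))" for u
  have k_meas[measurable]: "k \<in> borel_measurable borel" unfolding k_def by measurable
  have k0: "k u = 0" if "1 \<le> norm u" for u using norm_ge_1_bump[OF that] by (simp add: k_def)
  have k_bd: "norm (k u) \<le> 2" for u
    by (auto simp: k_def norm_mult)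
  have kd: "bounded_density k"
    unfolding bounded_density_def using k_meas k0 k_bd by blast
  have kcd: "bounded_density (\<lambda>u. k u * cnj u)"
    unfolding bounded_density_def
  proof (intro conjI exI allI impI)
    show "norm (k u * cnj u) \<le> 2" for u
    proof (cases "1 \<le> norm u")
      case False
      then have "norm (k u) * norm u \<le> 2 * 1" using k_bd by (intro mult_mono) auto
      then show ?thesis by (simp add: norm_mult)
    qed (simp add: k0)
    show "1 \<le> norm u \<Longrightarrow> k u * cnj u = 0" for u by (simp add: k0)
    have "cnj \<in> borel_measurable borel"
      by (intro borel_measurable_continuous_onI continuous_intros)
    then show "(\<lambda>u. k u * cnj u) \<in> borel_measurable borel" by measurable
  qed
  have k_int: "(LINT u|lborel. k u) = - of_real pi"
  proof -
    have "(LINT u|lborel. k u) = - (LINT u|lborel. of_real (2 * max 0 (1 - (norm (u::complex))\<^sup>2)))"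
      unfolding k_def by simp
    also have "(LINT u|lborel. of_real (2 * max 0 (1 - (norm (u::complex))\<^sup>2)) :: complex)
       = of_real (2 * (LINT u|lborel. max 0 (1 - (norm (u::complex))\<^sup>2)))"
      by (subst integral_complex_of_real) simp
    finally show ?thesis by (simp add: integral_paraboloid_cap)
  qed
  define p where "p = (LINT u|lborel. k u * cnj u / u)"
  define K where "K = cauchy_transform (\<lambda>\<rho>. bump (\<rho> - c))"
  have bm[measurable]: "bump \<in> borel_measurable borel" unfolding bump_def by measurable
  have K: "K z = (LINT u|lborel. bump (u + (z - c)) / u)" for z
    unfolding K_def cauchy_transform_def
    by (subst lborel_integral_translation[of _ z, symmetric]) (simp_all add: algebra_simps)
  have Ki: "integrable lborel (\<lambda>u. bump (u + v) / u)" for v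
    using cauchy_transform_integrable[OF bounded_density_bump[of "- v"], of 0] by simp
  have est: "norm (K y - K c - (p * (y - c) - of_real pi * cnj (y - c))) \<le> 27 * (norm (y - c))\<^sup>2 * (4 * pi * 3)"
    if "norm (y - c) \<le> 1" for y
  proof -
    define v where "v = y - c"
    have i1: "integrable lborel (\<lambda>u. v * (k u * cnj u / u))"
      using cauchy_transform_integrable[OF kcd, of 0] by (intro integrable_mult_right) simp
    have i2: "integrable lborel (\<lambda>u. cnj v * k u)"
      using bounded_density_integrable[OF kd] by (intro integrable_mult_right) 
    have i3: "integrable lborel (\<lambda>u. bump (u + v) / u - bump (u + 0) / u - (v * (k u * cnj u / u) + cnj v * k u))"
      by (rule Bochner_Integration.integrable_diff[OF Bochner_Integration.integrable_diff[OF Ki Ki]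
          Bochner_Integration.integrable_add[OF i1 i2]])
    have i4: "integrable lborel (\<lambda>u::complex. 27 * (norm v)\<^sup>2 * (indicator (ball 0 3) u / norm (u - 0)))"
      by (rule integrable_mult_right) (rule integrable_inverse_distance_ball, simp)
    have "K y - K c - (p * v - of_real pi * cnj v)
       = (LINT u|lborel. bump (u + v) / u) - (LINT u|lborel. bump (u + 0) / u)
          - ((LINT u|lborel. v * (k u * cnj u / u)) + (LINT u|lborel. cnj v * k u))"
    proof -
      have "K y = (LINT u|lborel. bump (u + v) / u)" "K c = (LINT u|lborel. bump (u + 0) / u)"
        unfolding v_def K by simp_all
      then show ?thesis
        by (simp only: integral_mult_right_zero k_int p_def[symmetric]) (simp only: mult_minus_right mult.commute add_uminus_conv_diff)
    qed
    also have "\<dots> = (LINT u|lborel. bump (u + v) / u - bump (u + 0) / u - (v * (k u * cnj u / u) + cnj v * k u))"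
      by (simp only: Bochner_Integration.integral_diff[OF Bochner_Integration.integrable_diff[OF Ki Ki]
            Bochner_Integration.integrable_add[OF i1 i2]]
          Bochner_Integration.integral_diff[OF Ki Ki] Bochner_Integration.integral_add[OF i1 i2])
    finally have eq: "K y - K c - (p * v - of_real pi * cnj v)
       = (LINT u|lborel. bump (u + v) / u - bump (u + 0) / u - (v * (k u * cnj u / u) + cnj v * k u))" .
    have "norm (K y - K c - (p * v - of_real pi * cnj v))
       \<le> (LINT u::complex|lborel. 27 * (norm v)\<^sup>2 * (indicator (ball 0 3) u / norm (u - 0)))"
      unfolding eq
    proof (rule norm_integral_le_integral_AE[OF i3 i4])
      have "AE u in lborel. u \<noteq> (0::complex)" by (rule AE_lborel_singleton)
      then show "AE u in lborel. norm (bump (u + v) / u - bump (u + 0) / u - (v * (k u * cnj u / u) + cnj v * k u))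
          \<le> 27 * (norm v)\<^sup>2 * (indicator (ball 0 3) u / norm (u - 0))"
      proof eventually_elim
        case (elim u)
        have "bump (u + v) / u - bump (u + 0) / u - (v * (k u * cnj u / u) + cnj v * k u)
          = (bump (u + v) - bump u + of_real (2 * max 0 (1 - (norm u)\<^sup>2)) * (v * cnj u + cnj v * u)) / u"
        proof -
          have "x / u - x' / u - (v * (- b * cnj u / u) + cnj v * - b) = (x - x' + b * (v * cnj u + cnj v * u)) / u"
            for x x' b :: complex
            using elim by (simp add: add_divide_distrib diff_divide_distrib distrib_left mult_ac)
          then show ?thesis by (simp only: k_def add_0_right)
        qed
        also have "norm \<dots> \<le> 27 * (norm v)\<^sup>2 * indicator (ball 0 3) u / norm u"
          unfolding norm_divide using that by (intro divide_right_mono bump_taylor) (auto simp: v_def)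
        finally show ?case by simp
      qed
    qed
    also have "\<dots> \<le> 27 * (norm v)\<^sup>2 * (4 * pi * 3)"
      unfolding integral_mult_right_zero using integral_inverse_distance_ball[of 3 0]
      by (intro mult_left_mono) auto
    finally show ?thesis by (simp only: v_def)
  qed
  have "(K has_derivative (\<lambda>h. p * h - of_real pi * cnj h)) (at c)"
  proof (rule has_derivativeI_sandwich[where e = 1 and H = "\<lambda>y. 27 * (12 * pi) * norm (y - c)"])
    show "bounded_linear (\<lambda>h. p * h - of_real pi * cnj h)"
      by (intro bounded_linear_sub bounded_linear_mult_right
          bounded_linear_compose[OF bounded_linear_mult_right bounded_linear_cnj])
    show "norm (K y - K c - (p * (y - c) - of_real pi * cnj (y - c))) / norm (y - c) \<le> 27 * (12 * pi) * norm (y - c)"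
      if "y \<noteq> c" "dist y c < 1" for y
    proof -
      have e: "27 * x\<^sup>2 * (4 * pi * 3) = 27 * (12 * pi) * x * x" for x :: real
        by (simp add: power2_eq_square)
      have n: "norm (y - c) \<le> 1" "0 < norm (y - c)" using that by (simp_all add: dist_norm)
      show ?thesis unfolding pos_divide_le_eq[OF n(2)] by (rule est[OF n(1), unfolded e])
    qed
    have "((\<lambda>y. 27 * (12 * pi) * norm (y - c)) \<longlongrightarrow> 27 * (12 * pi) * norm (c - c)) (at c)"
      by (intro tendsto_intros)
    then show "((\<lambda>y. 27 * (12 * pi) * norm (y - c)) \<longlongrightarrow> 0) (at c)" by simp
  qed auto
  then show ?thesis unfolding K_def by blast
qed

text \<open>
  If $G$ vanishes linearly at $c$, then $H(\rho) = G(\rho)/(\rho - c)$ is again a bounded density, and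
  the difference quotient at $c$ of the transform of $G$ is exactly the transform of $H$, which is continuous.
\<close>
lemma cauchy_transform_complex_derivative:
  assumes G: "bounded_density G" and d: "0 < d" and L: "\<And>\<rho>. dist \<rho> c < d \<Longrightarrow> norm (G \<rho>) \<le> L * norm (\<rho> - c)"
  shows "\<exists>p. (cauchy_transform G has_field_derivative p) (at c)"
proof -
  define H where "H \<rho> = G \<rho> / (\<rho> - c)" for \<rho>
  obtain M R where m: "G \<in> borel_measurable borel" "\<And>\<rho>. norm (G \<rho>) \<le> M" "\<And>\<rho>. R \<le> norm \<rho> \<Longrightarrow> G \<rho> = 0"
    using G by (auto simp: bounded_density_def)
  have Gc: "G c = 0" using L[of c] d by simp
  have "bounded_density H"
    unfolding bounded_density_def
  proof (intro conjI exI allI impI)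
    show "H \<in> borel_measurable borel" unfolding H_def using m(1) by measurable
    show "norm (H \<rho>) \<le> max \<bar>L\<bar> (M / d)" for \<rho>
    proof (cases "dist \<rho> c < d")
      case True
      have "norm (H \<rho>) \<le> \<bar>L\<bar>"
      proof (cases "\<rho> = c")
        case False
        have "norm (G \<rho>) \<le> \<bar>L\<bar> * norm (\<rho> - c)"
          by (rule order_trans[OF L[OF True] mult_right_mono]) auto
        then show ?thesis using False by (simp add: H_def norm_divide divide_le_eq)
      qed (simp add: H_def)
      then show ?thesis by simp
    next
      case False
      have "norm (H \<rho>) \<le> M / d"
        unfolding H_def norm_divide using m(2) False d by (intro frac_le order_trans[OF norm_ge_zero m(2)]) (auto simp: dist_norm)
      then show ?thesis by simp
    qed
    show "R \<le> norm \<rho> \<Longrightarrow> H \<rho> = 0" for \<rho> using m(3) by (simp add: H_def)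
  qed
  have eq: "cauchy_transform G z - cauchy_transform G c = cauchy_transform H z * (z - c)" for z
  proof -
    have "cauchy_transform G z - cauchy_transform G c = (LINT \<rho>|lborel. G \<rho> / (\<rho> - z) - G \<rho> / (\<rho> - c))"
      unfolding cauchy_transform_def
      by (rule Bochner_Integration.integral_diff[symmetric]) (intro cauchy_transform_integrable G)+
    also have "\<dots> = (LINT \<rho>|lborel. (z - c) * (H \<rho> / (\<rho> - z)))"
    proof (rule integral_cong_AE)
      have "AE \<rho> in lborel. \<rho> \<noteq> z" by (rule AE_lborel_singleton)
      then show "AE \<rho> in lborel. G \<rho> / (\<rho> - z) - G \<rho> / (\<rho> - c) = (z - c) * (H \<rho> / (\<rho> - z))"
      proof eventually_elim
        case (elim \<rho>)
        then show ?case using Gc by (cases "\<rho> = c") (auto simp: H_def field_simps)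
      qed
    qed (use m(1) in \<open>auto simp: H_def[abs_def]\<close>)
    finally show ?thesis by (simp only: cauchy_transform_def integral_mult_right_zero mult.commute)
  qed
  have "isCont (cauchy_transform H) c"
    using continuous_on_cauchy_transform[OF \<open>bounded_density H\<close>] by (simp add: continuous_on_eq_continuous_at)
  then show ?thesis unfolding DERIV_caratheodory_within using eq by blast
qed

text \<open>
  The transform inverts $-\partial_{\bar z}/\pi$ at every point where the density is Lipschitz:
  subtracting $f(c)$ times the bump leaves a density that vanishes linearly at $c$, and this contributes only a
  complex-linear term.
\<close>
theorem cauchy_transform_has_derivative:
  assumes f: "bounded_density f" and d: "0 < d"
    and L: "\<And>\<rho>. dist \<rho> c < d \<Longrightarrow> norm (f \<rho> - f c) \<le> L * norm (\<rho> - c)"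
  shows "\<exists>p. (cauchy_transform f has_derivative (\<lambda>h. p * h - of_real pi * f c * cnj h)) (at c)"
proof -
  define G where "G \<rho> = f \<rho> - f c * bump (\<rho> - c)" for \<rho>
  have fb: "bounded_density (\<lambda>\<rho>. f c * bump (\<rho> - c))" by (intro bounded_density_cmult bounded_density_bump)
  have G: "bounded_density G" unfolding G_def by (rule bounded_density_diff[OF f fb])
  have "\<exists>p. (cauchy_transform G has_field_derivative p) (at c)"
  proof (rule cauchy_transform_complex_derivative[OF G, where d = "min 1 d" and L = "L + norm (f c) * 2"])
    fix \<rho> assume "dist \<rho> c < min 1 d"
    then have r: "norm (\<rho> - c) \<le> 1" "dist \<rho> c < d" by (auto simp: dist_norm)
    have "norm (G \<rho>) = norm ((f \<rho> - f c) - f c * (bump (\<rho> - c) - 1))" by (simp add: G_def algebra_simps)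
    also have "\<dots> \<le> norm (f \<rho> - f c) + norm (f c) * norm (bump (\<rho> - c) - 1)"
      by (metis norm_triangle_ineq4 norm_mult)
    also have "\<dots> \<le> L * norm (\<rho> - c) + norm (f c) * (2 * norm (\<rho> - c))"
      using L[OF r(2)] bump_flat[OF r(1)] by (intro add_mono mult_left_mono) auto
    finally show "norm (G \<rho>) \<le> (L + norm (f c) * 2) * norm (\<rho> - c)" by (simp add: algebra_simps)
  qed (use d in auto)
  then obtain p where p: "(cauchy_transform G has_derivative (*) p) (at c)"
    unfolding has_field_derivative_def by blast
  obtain q where q: "(cauchy_transform (\<lambda>\<rho>. bump (\<rho> - c)) has_derivative (\<lambda>h. q * h - of_real pi * cnj h)) (at c)"
    using cauchy_transform_bump by blast
  have "cauchy_transform f z = cauchy_transform G z + f c * cauchy_transform (\<lambda>\<rho>. bump (\<rho> - c)) z" for z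
  proof -
    have "cauchy_transform f z = (LINT \<rho>|lborel. G \<rho> / (\<rho> - z) + f c * (bump (\<rho> - c) / (\<rho> - z)))"
      unfolding cauchy_transform_def by (rule Bochner_Integration.integral_cong) (auto simp: G_def diff_divide_distrib)
    also have "\<dots> = cauchy_transform G z + (LINT \<rho>|lborel. f c * (bump (\<rho> - c) / (\<rho> - z)))"
      unfolding cauchy_transform_def[of G]
      by (intro Bochner_Integration.integral_add cauchy_transform_integrable G integrable_mult_right bounded_density_bump)
    finally show ?thesis by (simp only: cauchy_transform_def integral_mult_right_zero)
  qed
  then have "cauchy_transform f = (\<lambda>z. cauchy_transform G z + f c * cauchy_transform (\<lambda>\<rho>. bump (\<rho> - c)) z)" by auto
  moreover have "((\<lambda>z. cauchy_transform G z + f c * cauchy_transform (\<lambda>\<rho>. bump (\<rho> - c)) z)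
     has_derivative (\<lambda>h. p * h + f c * (q * h - of_real pi * cnj h))) (at c)"
    by (intro has_derivative_add p has_derivative_mult_right q)
  ultimately show ?thesis by (intro exI[of _ "p + f c * q"]) (simp add: algebra_simps)
qed

section \<open>The similarity principle\<close>

lemma has_derivative_imp_pointwise_lipschitz:
  fixes f :: "'a::real_normed_vector \<Rightarrow> 'b::real_normed_vector"
  assumes "(f has_derivative f') (at c)"
  obtains d L where "0 < d" "\<And>y. dist y c < d \<Longrightarrow> norm (f y - f c) \<le> L * norm (y - c)"
proof -
  obtain K where K: "\<And>x. norm (f' x) \<le> norm x * K"
    using bounded_linear.bounded[OF has_derivative_bounded_linear[OF assms]] by blast
  obtain d where d: "0 < d" "\<And>y. norm (y - c) < d \<Longrightarrow> norm (f y - f c - f' (y - c)) \<le> 1 * norm (y - c)"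
    using assms unfolding has_derivative_at_alt by (metis zero_less_one)
  have "norm (f y - f c) \<le> (1 + K) * norm (y - c)" if "dist y c < d" for y
  proof -
    have "norm (f y - f c) \<le> norm (f y - f c - f' (y - c)) + norm (f' (y - c))"
      using norm_triangle_ineq[of "f y - f c - f' (y - c)" "f' (y - c)"] by simp
    also have "\<dots> \<le> 1 * norm (y - c) + norm (y - c) * K"
      using that by (intro add_mono d(2) K) (simp add: dist_norm)
    finally show ?thesis by (simp add: algebra_simps)
  qed
  with d(1) show thesis by (rule that)
qed

text \<open>
  The hypothesis on the derivative of $W$ says $\partial_{\bar z} W = - f W$. Where $W(c) \ne 0$, the density is
  differentiable, so the exponent has $\bar z$-derivative $f(c)$ and the two $\bar z$-derivatives
  cancel in the product. Where $W(c) = 0$, the density may be discontinuous; but there $W$ itself is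
  complex differentiable with value $0$, and multiplication by a continuous function preserves this.
  So the product is complex differentiable at every point, with no exceptional set to be removed.
\<close>
theorem similarity_principle:
  assumes f: "bounded_density f"
    and W: "\<And>c. c \<in> D \<Longrightarrow> (W has_derivative (\<lambda>h. P c * h - f c * W c * cnj h)) (at c)"
    and f': "\<And>c. c \<in> D \<Longrightarrow> W c \<noteq> 0 \<Longrightarrow> f differentiable (at c)"
  shows "(\<lambda>z. W z * exp (- (cauchy_transform f z / of_real pi))) holomorphic_on D"
proof -
  define E where "E z = exp (- (cauchy_transform f z / of_real pi))" for z
  have "\<exists>p. ((\<lambda>z. W z * E z) has_field_derivative p) (at c)" if c: "c \<in> D" for c
  proof (cases "W c = 0")
    case True
    \<comment> \<open>Caratheodory's form of the derivative: the slope function of the product is the slope of $W$ times $E$\<close>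
    have "(W has_field_derivative P c) (at c)"
      using W[OF c] True by (simp add: has_field_derivative_def)
    then obtain g where g: "\<And>z. W z - W c = g z * (z - c)" "isCont g c"
      unfolding CARAT_DERIV by blast
    have "continuous_on UNIV E"
      unfolding E_def by (intro continuous_intros continuous_on_cauchy_transform f) simp
    then have "isCont (\<lambda>z. g z * E z) c"
      using g(2) by (intro continuous_intros) (auto simp: continuous_on_eq_continuous_at)
    moreover have "W z * E z - W c * E c = g z * E z * (z - c)" for z
      using g(1)[of z] True by simp
    ultimately show ?thesis
      unfolding CARAT_DERIV by (intro exI[of _ "g c * E c"] exI[of _ "\<lambda>z. g z * E z"]) simp
  next
    case False
    then obtain f1 where "(f has_derivative f1) (at c)"
      using f'[OF c] by (auto simp: differentiable_def)
    then obtain d L where "0 < d" "\<And>y. dist y c < d \<Longrightarrow> norm (f y - f c) \<le> L * norm (y - c)"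
      using has_derivative_imp_pointwise_lipschitz by blast
    then obtain p where p: "(cauchy_transform f has_derivative (\<lambda>h. p * h - of_real pi * f c * cnj h)) (at c)"
      using cauchy_transform_has_derivative[OF f] by blast
    have arg: "((\<lambda>z. cauchy_transform f z * (- 1 / of_real pi)) has_derivative
        (\<lambda>h. (p * h - of_real pi * f c * cnj h) * (- 1 / of_real pi))) (at c)"
      by (rule has_derivative_mult_left[OF p])
    have E: "E = (\<lambda>z. exp (cauchy_transform f z * (- 1 / of_real pi)))"
      by (simp add: E_def fun_eq_iff)
    have dexp: "(exp has_derivative (*) (E c)) (at (cauchy_transform f c * (- 1 / of_real pi)))"
      using DERIV_exp[of "cauchy_transform f c * (- 1 / of_real pi)"] unfolding E has_field_derivative_def .
    have "(E has_derivative (\<lambda>h. E c * ((p * h - of_real pi * f c * cnj h) * (- 1 / of_real pi)))) (at c)"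
      using has_derivative_compose[OF arg dexp] unfolding E .
    from has_derivative_mult[OF W[OF c] this]
    have *: "((\<lambda>z. W z * E z) has_derivative (\<lambda>h. W c * (E c * ((p * h - of_real pi * f c * cnj h) * (- 1 / of_real pi)))
        + (P c * h - f c * W c * cnj h) * E c)) (at c)" .
    have eq: "(\<lambda>h. W c * (E c * ((p * h - of_real pi * f c * cnj h) * (- 1 / of_real pi)))
        + (P c * h - f c * W c * cnj h) * E c) = (*) (P c * E c - W c * E c * p / of_real pi)"
    proof
      fix h
      have "(p * h - of_real pi * f c * cnj h) * (- 1 / of_real pi) = f c * cnj h - p * h / of_real pi"
        by (simp add: field_simps)
      then show "W c * (E c * ((p * h - of_real pi * f c * cnj h) * (- 1 / of_real pi)))
          + (P c * h - f c * W c * cnj h) * E c = (P c * E c - W c * E c * p / of_real pi) * h"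
        by (simp only:) (simp add: algebra_simps)
    qed
    show ?thesis using *[unfolded eq] unfolding has_field_derivative_def by blast
  qed
  then have "(\<lambda>z. W z * E z) holomorphic_on D"
    unfolding holomorphic_on_def field_differentiable_def by (metis has_field_derivative_at_within)
  then show ?thesis unfolding E_def .
qed

section \<open>The meridian half-plane\<close>

definition meridian_point :: "'n::finite \<Rightarrow> complex \<Rightarrow> 'n point"
  where "meridian_point j z = (Re z, Im z *\<^sub>R axis j 1)"

lemma axial_coord_meridian_point: "0 \<le> Im z \<Longrightarrow> axial_coord (meridian_point j z) = z"
  by (simp add: axial_coord_def meridian_point_def complex_eq_iff)

lemma continuous_on_meridian_point: "continuous_on S (meridian_point j)"
  unfolding meridian_point_def by (intro continuous_intros)

lemma meridian_point_mem_iff: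
  assumes "axially_symmetric \<Omega>" "0 \<le> Im z"
  shows "meridian_point j z \<in> \<Omega> \<longleftrightarrow> z \<in> axial_coord ` \<Omega>"
proof
  assume "meridian_point j z \<in> \<Omega>"
  then show "z \<in> axial_coord ` \<Omega>"
    using axial_coord_meridian_point[OF assms(2), of j] by (metis imageI)
next
  assume "z \<in> axial_coord ` \<Omega>"
  then obtain x where x: "x \<in> \<Omega>" "z = axial_coord x" by blast
  then have "(fst x, norm (snd x) *\<^sub>R axis j 1) \<in> \<Omega>"
    using assms(1) unfolding axially_symmetric_def by force
  then show "meridian_point j z \<in> \<Omega>" using x by (simp add: meridian_point_def axial_coord_def)
qed

text \<open>
  A boundary point $t$ on the axis is impossible. If the defining function had a nonzero derivative in a
  direction $u$ orthogonal to the axis, the set would contain points slightly to one side of $t$ but not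
  their mirror images, against axial symmetry. So the derivative is nonzero along the axis,
  and then the set contains points of the axis near $t$.
  
  Consequently the coefficient $1/\eta$ of the plane equation stays bounded up to the boundary.
\<close>
lemma smooth_boundary_axis:
  fixes \<Omega> :: "'n::finite point set"
  assumes "open \<Omega>" and sym: "axially_symmetric \<Omega>" and smooth: "smooth_boundary \<Omega>"
    and off: "\<And>x. x \<in> \<Omega> \<Longrightarrow> snd x \<noteq> 0" and t: "t \<in> closure \<Omega>"
  shows "snd t \<noteq> 0"
proof
  assume t0: "snd t = 0"
  then have "t \<notin> \<Omega>" using off by blast
  then have fr: "t \<in> frontier \<Omega>" using t \<open>open \<Omega>\<close> by (simp add: frontier_def interior_open)
  then obtain U and \<rho> :: "'n point \<Rightarrow> real" where U: "open U" "t \<in> U" "\<And>k. ck_on k \<rho> U"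
      "frechet_derivative \<rho> (at t) \<noteq> (\<lambda>v. 0)" "\<Omega> \<inter> U = {x \<in> U. \<rho> x < 0}"
    using smooth[unfolded smooth_boundary_def, rule_format, OF fr] by blast
  define L where "L = frechet_derivative \<rho> (at t)"
  have "\<rho> differentiable (at t)" using U(2) U(3)[of 1] by auto
  then have der: "(\<rho> has_derivative L) (at t)" unfolding L_def by (simp add: frechet_derivative_works)
  then have lin: "linear L" by (rule has_derivative_linear)
  have "\<rho> t \<ge> 0" using U(2,5) \<open>t \<notin> \<Omega>\<close> by force
  moreover have "\<rho> t \<le> 0"
  proof (rule ccontr)
    assume "\<not> \<rho> t \<le> 0"
    moreover have "isCont \<rho> t" using der by (rule has_derivative_continuous)
    ultimately have "\<forall>\<^sub>F x in nhds t. 0 < \<rho> x"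
      by (intro order_tendstoD(1)) (auto simp: isCont_def tendsto_nhds_iff)
    then obtain V where V: "open V" "t \<in> V" "\<And>x. x \<in> V \<Longrightarrow> 0 < \<rho> x"
      unfolding eventually_nhds by blast
    have "\<rho> x < 0" if "x \<in> \<Omega> \<inter> U" for x using U(5) that by blast
    then have "\<Omega> \<inter> (V \<inter> U) = {}" using V(3) by (meson Int_iff disjoint_iff less_asym)
    moreover have "open (V \<inter> U)" "t \<in> V \<inter> U" using V U by auto
    ultimately show False using t open_Int_closure_eq_empty[of "V \<inter> U" \<Omega>] by blast
  qed
  ultimately have \<rho>t: "\<rho> t = 0" by simp
  have line: "((\<lambda>s. \<rho> (t + s *\<^sub>R v)) has_real_derivative L v) (at 0)" for v
  proof -
    have "((\<lambda>s. t + s *\<^sub>R v) has_derivative (\<lambda>s. s *\<^sub>R v)) (at 0)"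
      by (auto intro!: derivative_eq_intros)
    moreover have "(\<rho> has_derivative L) (at (t + 0 *\<^sub>R v))" using der by simp
    ultimately have "((\<lambda>s. \<rho> (t + s *\<^sub>R v)) has_derivative (\<lambda>s. L (s *\<^sub>R v))) (at 0)"
      by (rule has_derivative_compose)
    moreover have "(\<lambda>s. L (s *\<^sub>R v)) = (*) (L v)"
      by (simp add: fun_eq_iff linear_scale[OF lin])
    ultimately show ?thesis by (simp add: has_field_derivative_def)
  qed
  have inU: "\<exists>d>0. \<forall>s. 0 < s \<longrightarrow> s < d \<longrightarrow> t + s *\<^sub>R v \<in> U" for v :: "'n point"
  proof -
    have "((\<lambda>s. t + s *\<^sub>R v) \<longlongrightarrow> t + 0 *\<^sub>R v) (at_right 0)" by (intro tendsto_intros)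
    then have "\<forall>\<^sub>F s in at_right 0. t + s *\<^sub>R v \<in> U"
      using U(1,2) by (auto simp: tendsto_def)
    then show ?thesis by (auto simp: eventually_at_right_field)
  qed
  have neg: "\<exists>d>0. \<forall>s. 0 < s \<longrightarrow> s < d \<longrightarrow> t + s *\<^sub>R v \<in> \<Omega>" if Lv: "L v < 0" for v
  proof -
    obtain d1 where d1: "0 < d1" "\<And>s. 0 < s \<Longrightarrow> s < d1 \<Longrightarrow> t + s *\<^sub>R v \<in> U" using inU[of v] by blast
    obtain d2 where d2: "0 < d2" "\<And>s. 0 < s \<Longrightarrow> s < d2 \<Longrightarrow> \<rho> (t + s *\<^sub>R v) < 0"
      using DERIV_neg_dec_right[OF line Lv] \<rho>t by auto
    show ?thesis using d1 d2 U(5) by (intro exI[of _ "min d1 d2"]) auto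
  qed
  have pos: "\<exists>d>0. \<forall>s. 0 < s \<longrightarrow> s < d \<longrightarrow> t + s *\<^sub>R v \<notin> \<Omega>" if Lv: "L v > 0" for v
  proof -
    obtain d1 where d1: "0 < d1" "\<And>s. 0 < s \<Longrightarrow> s < d1 \<Longrightarrow> t + s *\<^sub>R v \<in> U" using inU[of v] by blast
    obtain d2 where d2: "0 < d2" "\<And>s. 0 < s \<Longrightarrow> s < d2 \<Longrightarrow> \<rho> (t + s *\<^sub>R v) > 0"
      using DERIV_pos_inc_right[OF line Lv] \<rho>t by auto
    show ?thesis
    proof (intro exI[of _ "min d1 d2"] conjI allI impI)
      fix s assume s: "0 < s" "s < min d1 d2"
      then have "t + s *\<^sub>R v \<in> U" "\<not> \<rho> (t + s *\<^sub>R v) < 0" using d1(2)[of s] d2(2)[of s] by auto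
      then show "t + s *\<^sub>R v \<notin> \<Omega>" using U(5) by blast
    qed (use d1 d2 in auto)
  qed
  have vert: "\<not> L (0, u) < 0" for u :: "real ^ 'n"
  proof
    assume L: "L (0, u) < 0"
    have "L (0, - u) = - L (0, u)" using linear_neg[OF lin, of "(0, u)"] by simp
    then have "L (0, - u) > 0" using L by simp
    from neg[OF L] pos[OF this] obtain d1 d2 where
      d: "0 < d1" "0 < d2" "\<And>s. 0 < s \<Longrightarrow> s < d1 \<Longrightarrow> t + s *\<^sub>R (0, u) \<in> \<Omega>"
        "\<And>s. 0 < s \<Longrightarrow> s < d2 \<Longrightarrow> t + s *\<^sub>R (0, - u) \<notin> \<Omega>" by metis
    define s where "s = min d1 d2 / 2"
    have s: "0 < s" "s < d1" "s < d2" using d(1,2) by (auto simp: s_def)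
    have "u \<noteq> 0" using L linear_0[OF lin] by (auto simp: zero_prod_def)
    define \<omega> where "\<omega> = - (u /\<^sub>R norm u)"
    have x: "t + s *\<^sub>R (0, u) \<in> \<Omega>" using d(3) s by blast
    have "norm \<omega> = 1" using \<open>u \<noteq> 0\<close> by (simp add: \<omega>_def)
    then have "(fst (t + s *\<^sub>R (0, u)), norm (snd (t + s *\<^sub>R (0, u))) *\<^sub>R \<omega>) \<in> \<Omega>"
      using sym x unfolding axially_symmetric_def by blast
    moreover have "(fst (t + s *\<^sub>R (0, u)), norm (snd (t + s *\<^sub>R (0, u))) *\<^sub>R \<omega>) = t + s *\<^sub>R (0, - u)"
      using s t0 \<open>u \<noteq> 0\<close> by (simp add: prod_eq_iff \<omega>_def)
    ultimately show False using d(4)[of s] s by simp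
  qed
  have vert0: "L (0, u) = 0" for u :: "real ^ 'n"
    using vert[of u] vert[of "- u"] linear_neg[OF lin, of "(0, u)"] by simp
  have "L (1, 0) \<noteq> 0"
  proof
    assume "L (1, 0) = 0"
    then have "L v = 0" for v
      using linear_add[OF lin, of "fst v *\<^sub>R (1, 0)" "(0, snd v)"] linear_scale[OF lin, of "fst v" "(1, 0)"]
        vert0[of "snd v"] by simp
    then show False using U(4) L_def by auto
  qed
  then obtain a :: real where "L (a, 0) < 0"
    using linear_neg[OF lin, of "(1, 0)"] by (cases "L (1, 0) < 0") (auto intro: that[of 1] that[of "- 1"])
  then obtain d where d: "0 < d" "\<And>s. 0 < s \<Longrightarrow> s < d \<Longrightarrow> t + s *\<^sub>R (a, 0) \<in> \<Omega>" using neg by metis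
  have "t + (d / 2) *\<^sub>R (a, 0) \<in> \<Omega>" using d(1) by (intro d(2)) auto
  from off[OF this] t0 show False by simp
qed

lemma meridian_domain:
  fixes \<Omega> :: "'n::finite point set"
  assumes \<Omega>: "open \<Omega>" "axially_symmetric \<Omega>" "smooth_boundary \<Omega>"
    and upper: "axial_coord ` \<Omega> \<subseteq> {z. Im z > 0}"
  shows open_meridian_domain: "open (axial_coord ` \<Omega>)"
    and closure_meridian_domain: "\<And>z. z \<in> closure (axial_coord ` \<Omega>) \<Longrightarrow> 0 < Im z \<and> meridian_point j z \<in> closure \<Omega>"
    and frontier_meridian_domain: "\<And>z. z \<in> frontier (axial_coord ` \<Omega>) \<Longrightarrow> meridian_point j z \<in> frontier \<Omega>"
proof -
  let ?D = "axial_coord ` \<Omega>"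
  have D: "?D = {z. 0 < Im z} \<inter> meridian_point j -` \<Omega>"
  proof (rule set_eqI)
    show "z \<in> ?D \<longleftrightarrow> z \<in> {z. 0 < Im z} \<inter> meridian_point j -` \<Omega>" for z
      using meridian_point_mem_iff[OF \<Omega>(2), of z j] upper by (cases "0 < Im z") auto
  qed
  have "open (meridian_point j -` \<Omega>)"
    using \<Omega>(1) continuous_on_meridian_point by (rule open_vimage)
  then show op: "open ?D"
    unfolding D by (intro open_Int open_halfspace_Im_gt)
  have off: "snd x \<noteq> 0" if "x \<in> \<Omega>" for x
    using upper that by (force simp: axial_coord_def)
  show cl: "0 < Im z \<and> meridian_point j z \<in> closure \<Omega>" if z: "z \<in> closure ?D" for z
  proof
    have "meridian_point j ` ?D \<subseteq> closure \<Omega>"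
      using closure_subset[of \<Omega>] unfolding D by auto
    then have "meridian_point j ` closure ?D \<subseteq> closure \<Omega>"
      by (intro image_closure_subset continuous_on_meridian_point) auto
    then show mem: "meridian_point j z \<in> closure \<Omega>" using z by blast
    have "snd (meridian_point j z) \<noteq> 0"
      by (rule smooth_boundary_axis[OF \<Omega> off mem])
    moreover have "0 \<le> Im z"
    proof -
      have "closure ?D \<subseteq> {z. 0 \<le> Im z}"
        using upper by (intro closure_minimal closed_halfspace_Im_ge) auto
      then show ?thesis using z by blast
    qed
    ultimately show "0 < Im z" by (cases "Im z = 0") (auto simp: meridian_point_def)
  qed
  show "meridian_point j z \<in> frontier \<Omega>" if z: "z \<in> frontier ?D" for z
  proof -
    have "z \<in> closure ?D" "z \<notin> ?D" using z op by (auto simp: frontier_def interior_open)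
    moreover from this have "0 < Im z" "meridian_point j z \<in> closure \<Omega>" using cl by auto
    ultimately show ?thesis
      using meridian_point_mem_iff[OF \<Omega>(2), of z j] \<Omega>(1) by (simp add: frontier_def interior_open)
  qed
qed

section \<open>From the Clifford equation to the Vekua equation\<close>

lemma cl_scalar_component: "cl_scalar s $ A = (if A = {} then s else 0)"
  by (simp add: cl_scalar_def blade_def axis_def)

lemma cl_e_component: "cl_e j $ A = (if A = {j} then 1 else 0)"
  by (simp add: cl_e_def blade_def axis_def)

lemma cl_vector_axis: "cl_vector (axis j 1) = cl_e j"
proof -
  have "(\<Sum>k\<in>UNIV. (axis j 1 $ k) *\<^sub>R cl_e k) = (\<Sum>k\<in>UNIV. if k = j then cl_e j else 0)"
    by (rule sum.cong) (auto simp: axis_def)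
  then show ?thesis by (simp add: cl_vector_def)
qed

lemma linear_cl_vector: "linear cl_vector"
  by (rule linearI) (simp_all add: cl_vector_def scaleR_add_left sum.distrib scaleR_sum_right)

lemma cl_e_mult_component_scalar: "(cl_e j \<star> y) $ {} = - (y $ {j})"
proof -
  have "(cl_e j \<star> y) $ {} = (cl_e j \<star> (\<Sum>A\<in>UNIV. (y $ A) *\<^sub>R blade A)) $ {}"
    by (simp flip: cl_expand)
  also have "\<dots> = (\<Sum>A\<in>UNIV. y $ A * (blade_sign {j} A * (blade (sym_diff {j} A) $ {})))"
    by (simp add: cl_mult.sum_right cl_mult.scaleR_right cl_e_def blade_mult mult.assoc)
  also have "\<dots> = (\<Sum>A\<in>UNIV. if A = {j} then - (y $ {j}) else 0)"
    by (rule sum.cong) (auto simp: blade_def axis_def blade_sign_prod)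
  finally show ?thesis by simp
qed

lemma cl_e_mult_component_vector:
  fixes y :: "'n::{finite,linorder} clifford"
  shows "(cl_e j \<star> y) $ {j} = y $ {}"
proof -
  have "(cl_e j \<star> y) $ {j} = (cl_e j \<star> (\<Sum>A\<in>UNIV. (y $ A) *\<^sub>R blade A)) $ {j}"
    by (simp flip: cl_expand)
  also have "\<dots> = (\<Sum>A\<in>UNIV. y $ A * (blade_sign {j} A * (blade (sym_diff {j} A) $ {j})))"
    by (simp add: cl_mult.sum_right cl_mult.scaleR_right cl_e_def blade_mult mult.assoc)
  also have "\<dots> = (\<Sum>A\<in>UNIV. if A = ({} :: 'n set) then y $ {} else 0)"
    by (rule sum.cong) (auto simp: blade_def axis_def blade_sign_prod)
  finally show ?thesis by simp
qed

text \<open>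
  Along the circle $s \mapsto r(\cos s\,e_j + \sin s\,e_k)$ the components $A$ and $B$ are constant and only the
  unit vector moves. This yields the derivative of $\phi$ across the half-plane without any
  differentiability of $A$ and $B$.
\<close>
lemma axial_tangential_derivative:
  fixes \<phi> :: "'n::{finite,linorder} point \<Rightarrow> 'n clifford"
  assumes sym: "axially_symmetric \<Omega>" and rep: "axial_rep \<Omega> \<phi> A B"
    and x: "meridian_point j c \<in> \<Omega>" and r: "0 < Im c"
    and F: "(\<phi> has_derivative F) (at (meridian_point j c))" and k: "k \<noteq> j"
  shows "F (0, axis k 1) = (B (Re c) (Im c) / Im c) *\<^sub>R cl_e k"
proof -
  define \<omega> :: "real \<Rightarrow> (real, 'n) vec" where "\<omega> s = cos s *\<^sub>R axis j 1 + sin s *\<^sub>R axis k 1" for s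
  have "norm (\<omega> s) = 1" for s
  proof -
    have "\<omega> s \<bullet> \<omega> s = 1"
      using k sin_cos_squared_add2[of s]
      by (simp add: \<omega>_def inner_add_left inner_add_right inner_axis_axis power2_eq_square)
    then show ?thesis by (simp add: norm_eq_sqrt_inner)
  qed
  note n = this
  define \<gamma> where "\<gamma> s = (Re c, Im c *\<^sub>R \<omega> s)" for s
  have "\<gamma> s \<in> \<Omega>" for s
  proof -
    have "(fst (meridian_point j c), norm (snd (meridian_point j c)) *\<^sub>R \<omega> s) \<in> \<Omega>"
      using sym x n[of s] unfolding axially_symmetric_def by blast
    then show ?thesis using r by (simp add: \<gamma>_def meridian_point_def)
  qed
  then have "\<phi> (\<gamma> s) = cl_scalar (A (Re c) (Im c)) + B (Re c) (Im c) *\<^sub>R cl_vector (\<omega> s)" for s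
    using rep n[of s] r unfolding axial_rep_def by (force simp: \<gamma>_def)
  then have eq: "(\<phi> \<circ> \<gamma>) = (\<lambda>s. cl_scalar (A (Re c) (Im c)) + B (Re c) (Im c) *\<^sub>R (cos s *\<^sub>R cl_e j + sin s *\<^sub>R cl_e k))"
    by (simp add: fun_eq_iff \<omega>_def linear_add[OF linear_cl_vector] linear_scale[OF linear_cl_vector] cl_vector_axis)
  have d1: "((\<phi> \<circ> \<gamma>) has_vector_derivative B (Re c) (Im c) *\<^sub>R cl_e k) (at 0)"
    unfolding eq has_vector_derivative_def by (auto intro!: derivative_eq_intros simp: scaleR_right_distrib)
  have "(\<gamma> has_vector_derivative (0, Im c *\<^sub>R axis k 1)) (at 0)"
    unfolding \<gamma>_def \<omega>_def has_vector_derivative_def by (auto intro!: derivative_eq_intros)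
  moreover have "\<gamma> 0 = meridian_point j c" by (simp add: \<gamma>_def \<omega>_def meridian_point_def)
  ultimately have "((\<phi> \<circ> \<gamma>) has_vector_derivative F (0, Im c *\<^sub>R axis k 1)) (at 0)"
    using F by (intro vector_derivative_diff_chain_within[where S = UNIV and f' = "(0, Im c *\<^sub>R axis k 1)" and g' = F, simplified]) (auto intro: has_derivative_at_withinI)
  then have "F (0, Im c *\<^sub>R axis k 1) = B (Re c) (Im c) *\<^sub>R cl_e k"
    using d1 by (rule vector_derivative_unique_at)
  moreover have "F (0, Im c *\<^sub>R axis k 1) = Im c *\<^sub>R F (0, axis k 1)"
    using linear_scale[OF has_derivative_linear[OF F], of "Im c" "(0, axis k 1)"] by simp
  ultimately have "Im c *\<^sub>R F (0, axis k 1) = B (Re c) (Im c) *\<^sub>R cl_e k" by simp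
  then have "inverse (Im c) *\<^sub>R (Im c *\<^sub>R F (0, axis k 1)) = inverse (Im c) *\<^sub>R (B (Re c) (Im c) *\<^sub>R cl_e k)"
    by (rule arg_cong)
  then show ?thesis using r by (simp add: divide_inverse mult.commute)
qed

text \<open>
  The function $w = e^{-\alpha x_0}(A + \mathrm{i} B)$: in a half-plane bounded by the axis, $A$ and $B$ are the
  coordinates of $\phi$ along the blades $\emptyset$ and $\{j\}$.
\<close>
definition meridian_function ::
    "real \<Rightarrow> 'n::{finite,linorder} \<Rightarrow> ('n point \<Rightarrow> 'n clifford) \<Rightarrow> complex \<Rightarrow> complex"
  where "meridian_function \<alpha> j \<phi> z = of_real (exp (- \<alpha> * Re z)) *
    Complex (\<phi> (meridian_point j z) $ {}) (\<phi> (meridian_point j z) $ {j})"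

lemma axial_rep_meridian_point:
  assumes "axial_rep S \<phi> A B" "meridian_point j z \<in> S" "0 < Im z"
  shows "\<phi> (meridian_point j z) $ {} = A (Re z) (Im z)"
    and "\<phi> (meridian_point j z) $ {j} = B (Re z) (Im z)"
proof -
  have "\<phi> (meridian_point j z) = cl_scalar (A (Re z) (Im z)) + B (Re z) (Im z) *\<^sub>R cl_vector (axis j 1)"
    using assms unfolding axial_rep_def meridian_point_def by force
  then show "\<phi> (meridian_point j z) $ {} = A (Re z) (Im z)"
    and "\<phi> (meridian_point j z) $ {j} = B (Re z) (Im z)"
    by (simp_all add: cl_vector_axis cl_scalar_component cl_e_component)
qed

text \<open>
  The coordinates of the Clifford equation along $\emptyset$ and $\{j\}$ are
  $\partial_{x_0} A - \partial_r B - \frac{n-1}{r} B = \alpha A$ and $\partial_{x_0} B + \partial_r A = \alpha B$, where each of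
  the $n - 1$ directions orthogonal to the half-plane contributes $-B/r$. The factor $e^{-\alpha x_0}$ absorbs the terms
  with $\alpha$, and what remains is
  $\partial_{\bar z} w = -\frac{(n-1)\mathrm{i}}{4 r}(w - \bar w)$.
\<close>
lemma vekua_equation:
  fixes \<phi> :: "'n::{finite,linorder} point \<Rightarrow> 'n clifford"
  assumes sym: "axially_symmetric \<Omega>" and rep: "axial_rep \<Omega> \<phi> A B"
    and x: "meridian_point j c \<in> \<Omega>" and r: "0 < Im c"
    and diff: "\<phi> differentiable (at (meridian_point j c))"
    and eq: "cauchy_riemann \<phi> (meridian_point j c) - \<alpha> *\<^sub>R \<phi> (meridian_point j c) = 0"
  defines "w \<equiv> meridian_function \<alpha> j \<phi>"
  shows "\<exists>P. (w has_derivative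
    (\<lambda>h. P * h - (of_nat CARD('n) - 1) * \<i> / (4 * of_real (Im c)) * (w c - cnj (w c)) * cnj h)) (at c)"
proof -
  define x0 where "x0 = meridian_point j c"
  define F where "F = frechet_derivative \<phi> (at x0)"
  define X where "X = F (1, 0)"
  define R where "R = F (0, axis j 1)"
  define u where "u z = \<phi> (meridian_point j z) $ {}" for z
  define v where "v z = \<phi> (meridian_point j z) $ {j}" for z
  define E where "E = exp (- \<alpha> * Re c)"
  define T where "T = (real CARD('n) - 1) * (v c / Im c)"
  have F: "(\<phi> has_derivative F) (at x0)"
    using diff unfolding F_def x0_def by (simp add: frechet_derivative_works)
  have B: "B (Re c) (Im c) = v c"
    unfolding v_def using axial_rep_meridian_point(2)[OF rep x r] by simp
  have tang: "F (0, axis k 1) = (v c / Im c) *\<^sub>R cl_e k" if "k \<noteq> j" for k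
    using axial_tangential_derivative[OF sym rep x r F[unfolded x0_def] that] B by simp
  have "(\<Sum>k\<in>UNIV. cl_e k \<star> F (0, axis k 1)) = cl_e j \<star> R + (\<Sum>k\<in>UNIV - {j}. cl_e k \<star> F (0, axis k 1))"
    unfolding R_def by (rule sum.remove) auto
  moreover have "(\<Sum>k\<in>UNIV - {j}. cl_e k \<star> F (0, axis k 1)) = (\<Sum>k\<in>UNIV - {j}. (v c / Im c) *\<^sub>R cl_scalar (- 1))"
    by (rule sum.cong) (auto simp: tang cl_mult.scaleR_right cl_e_square)
  moreover have "(\<Sum>k\<in>UNIV - {j}. (v c / Im c) *\<^sub>R (cl_scalar (- 1) :: 'n clifford)) = T *\<^sub>R cl_scalar (- 1)"
  proof -
    have "card (UNIV - {j}) = CARD('n) - 1" by (rule card_Diff_singleton) simp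
    moreover have "1 \<le> CARD('n)" by (simp add: Suc_le_eq)
    ultimately show ?thesis by (simp only: sum_constant_scaleR of_nat_diff of_nat_1 scaleR_scaleR T_def)
  qed
  ultimately have sum: "(\<Sum>k\<in>UNIV. cl_e k \<star> F (0, axis k 1)) = cl_e j \<star> R + T *\<^sub>R cl_scalar (- 1)"
    by (simp only:)
  have "X + (cl_e j \<star> R + T *\<^sub>R cl_scalar (- 1)) - \<alpha> *\<^sub>R \<phi> x0 = 0"
    using eq unfolding cauchy_riemann_def x0_def[symmetric] F_def[symmetric] sum X_def[symmetric] .
  note eqs = arg_cong[OF this, of "\<lambda>y. y $ {}"] arg_cong[OF this, of "\<lambda>y. y $ {j}"]
  have e1: "X $ {} - R $ {j} - T - \<alpha> * u c = 0"
    using eqs(1) by (simp add: cl_e_mult_component_scalar cl_scalar_component u_def x0_def algebra_simps)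
  have e2: "X $ {j} + R $ {} - \<alpha> * v c = 0"
    using eqs(2) by (simp add: cl_e_mult_component_vector cl_scalar_component v_def x0_def algebra_simps)
  \<comment> \<open>$a$ and $d$ below are the partial derivatives of $w$; its $\bar z$-derivative is $(a + \mathrm{i} d)/2$\<close>
  have m: "(meridian_point j has_derivative (\<lambda>h. (Re h, Im h *\<^sub>R axis j 1))) (at c)"
    unfolding meridian_point_def by (auto intro!: derivative_eq_intros)
  have split: "F (Re h, Im h *\<^sub>R axis j 1) = Re h *\<^sub>R X + Im h *\<^sub>R R" for h
  proof -
    have "F (Re h, Im h *\<^sub>R axis j 1) = F (Re h *\<^sub>R (1, 0) + Im h *\<^sub>R (0, axis j 1))" by simp
    also have "\<dots> = Re h *\<^sub>R X + Im h *\<^sub>R R"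
      unfolding X_def R_def linear_add[OF has_derivative_linear[OF F]] linear_scale[OF has_derivative_linear[OF F]] ..
    finally show ?thesis .
  qed
  have comp: "((\<lambda>z. \<phi> (meridian_point j z) $ S) has_derivative (\<lambda>h. Re h * X $ S + Im h * R $ S)) (at c)" for S
  proof -
    have "((\<lambda>z. \<phi> (meridian_point j z)) has_derivative (\<lambda>h. Re h *\<^sub>R X + Im h *\<^sub>R R)) (at c)"
      using has_derivative_compose[OF m F[unfolded x0_def]] unfolding split .
    from bounded_linear.has_derivative[OF bounded_linear_vec_nth this, of S]
    show ?thesis by simp
  qed
  have wdef: "w = (\<lambda>z. of_real (exp (- \<alpha> * Re z)) * (of_real (u z) + \<i> * of_real (v z)))"
    by (simp add: w_def meridian_function_def u_def v_def fun_eq_iff Complex_eq)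
  define a where "a = E * (X $ {} + \<i> * X $ {j} - \<alpha> * (u c + \<i> * v c))"
  define d where "d = E * (R $ {} + \<i> * R $ {j})"
  have "(w has_derivative (\<lambda>h. of_real (Re h) * a + of_real (Im h) * d)) (at c)"
  proof -
    have "((\<lambda>z. exp (- \<alpha> * Re z)) has_derivative (\<lambda>h. - \<alpha> * Re h * E)) (at c)"
      unfolding E_def by (auto intro!: derivative_eq_intros)
    then have g1: "((\<lambda>z. complex_of_real (exp (- \<alpha> * Re z))) has_derivative (\<lambda>h. of_real (- \<alpha> * Re h * E))) (at c)"
      by (rule bounded_linear.has_derivative[OF bounded_linear_of_real])
    have g2: "((\<lambda>z. complex_of_real (u z) + \<i> * of_real (v z)) has_derivative
        (\<lambda>h. of_real (Re h * X $ {} + Im h * R $ {}) + \<i> * of_real (Re h * X $ {j} + Im h * R $ {j}))) (at c)"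
      unfolding u_def v_def
      by (intro has_derivative_add has_derivative_mult_right bounded_linear.has_derivative[OF bounded_linear_of_real] comp)
    have eq: "(\<lambda>h. of_real (exp (- \<alpha> * Re c)) *
          (of_real (Re h * X $ {} + Im h * R $ {}) + \<i> * of_real (Re h * X $ {j} + Im h * R $ {j}))
        + of_real (- \<alpha> * Re h * E) * (of_real (u c) + \<i> * of_real (v c)))
      = (\<lambda>h. of_real (Re h) * a + of_real (Im h) * d)"
      by (simp add: fun_eq_iff a_def d_def E_def complex_eq_iff algebra_simps)
    show ?thesis using has_derivative_mult[OF g1 g2] unfolding eq wdef .
  qed
  moreover have "of_real (Re h) * a + of_real (Im h) * d
     = (a - \<i> * d) / 2 * h - (of_nat CARD('n) - 1) * \<i> / (4 * of_real (Im c)) * (w c - cnj (w c)) * cnj h" for h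
  proof -
    have wc: "(of_nat CARD('n) - 1) * \<i> / (4 * of_real (Im c)) * (w c - cnj (w c))
        = - of_real (E * T / 2)"
      using r by (simp add: wdef E_def T_def complex_eq_iff field_simps)
    have "a + \<i> * d = of_real (E * T)"
    proof -
      have "a + \<i> * d = of_real (E * (X $ {} - R $ {j} - \<alpha> * u c)) + \<i> * of_real (E * (X $ {j} + R $ {} - \<alpha> * v c))"
        by (simp add: a_def d_def complex_eq_iff algebra_simps)
      moreover have "X $ {} - R $ {j} - \<alpha> * u c = T" using e1 by linarith
      ultimately show ?thesis using e2 by (simp only:) simp
    qed
    then have Q: "(of_nat CARD('n) - 1) * \<i> / (4 * of_real (Im c)) * (w c - cnj (w c)) = - ((a + \<i> * d) / 2)"
      unfolding wc by simp
    have h: "h = of_real (Re h) + \<i> * of_real (Im h)" "cnj h = of_real (Re h) - \<i> * of_real (Im h)"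
      by (simp_all add: complex_eq_iff)
    have "of_real (Re h) * a + of_real (Im h) * d = (a - \<i> * d) / 2 * h + (a + \<i> * d) / 2 * cnj h"
      unfolding h(2) by (subst (3) h(1)) (simp add: algebra_simps diff_divide_distrib add_divide_distrib)
    then show ?thesis unfolding Q by (simp only: mult_minus_left diff_minus_eq_add)
  qed
  ultimately show ?thesis by (intro exI[of _ "(a - \<i> * d) / 2"]) simp
qed

text \<open>
  The density whose Cauchy transform, divided by $\pi$, is the exponent $\nu$. At zeros of $w$ the quotient
  $\bar w/w$ has the value $0$, so $f w = \frac{(n-1)\mathrm{i}}{4 \eta}(w - \bar w)$ holds at all points.
\<close>
definition vekua_density :: "nat \<Rightarrow> complex set \<Rightarrow> (complex \<Rightarrow> complex) \<Rightarrow> complex \<Rightarrow> complex"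
  where "vekua_density n D w \<rho> = indicat_real D \<rho> *\<^sub>R
    ((of_nat n - 1) * \<i> / (4 * of_real (Im \<rho>))
     - (of_nat n - 1) * \<i> / (4 * of_real (Im \<rho>)) * (cnj (w \<rho>) / w \<rho>))"

lemma vekua_exponent_eq_cauchy_transform:
  "vekua_exponent n D w z = cauchy_transform (vekua_density n D w) z / of_real pi"
  by (simp add: vekua_exponent_def set_lebesgue_integral_def cauchy_transform_def vekua_density_def
      scaleR_conv_of_real)

lemma bounded_density_vekua_density:
  assumes D: "open D" "compact (closure D)" "\<And>z. z \<in> closure D \<Longrightarrow> 0 < Im z"
    and w: "continuous_on D w"
  shows "bounded_density (vekua_density n D w)"
proof (cases "D = {}")
  case True
  then show ?thesis by (auto simp: bounded_density_def vekua_density_def[abs_def])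
next
  case False
  then have "closure D \<noteq> {}" by simp
  moreover have "continuous_on (closure D) Im" by (intro continuous_intros)
  ultimately obtain z0 where z0: "z0 \<in> closure D" "\<And>z. z \<in> closure D \<Longrightarrow> Im z0 \<le> Im z"
    using continuous_attains_inf[OF D(2), of Im] by blast
  define d where "d = Im z0"
  have d: "0 < d" "\<And>z. z \<in> D \<Longrightarrow> d \<le> Im z"
    using z0 D(3) closure_subset[of D] by (auto simp: d_def)
  obtain R where R: "\<And>z. z \<in> closure D \<Longrightarrow> norm z \<le> R"
    using compact_imp_bounded[OF D(2)] by (auto simp: bounded_iff)
  have m: "(\<lambda>\<rho>. indicat_real D \<rho> *\<^sub>R w \<rho>) \<in> borel_measurable borel"
    using w D(1) by (intro borel_measurable_continuous_on_indicator) auto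
  have cm: "cnj \<in> borel_measurable borel" by (intro borel_measurable_continuous_onI continuous_intros)
  have eq: "vekua_density n D w = (\<lambda>\<rho>. indicat_real D \<rho> *\<^sub>R
    ((of_nat n - 1) * \<i> / (4 * of_real (Im \<rho>))
     - (of_nat n - 1) * \<i> / (4 * of_real (Im \<rho>)) * (cnj (indicat_real D \<rho> *\<^sub>R w \<rho>) / (indicat_real D \<rho> *\<^sub>R w \<rho>))))"
  proof
    fix \<rho>
    show "vekua_density n D w \<rho> = indicat_real D \<rho> *\<^sub>R
      ((of_nat n - 1) * \<i> / (4 * of_real (Im \<rho>))
       - (of_nat n - 1) * \<i> / (4 * of_real (Im \<rho>)) * (cnj (indicat_real D \<rho> *\<^sub>R w \<rho>) / (indicat_real D \<rho> *\<^sub>R w \<rho>)))"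
      unfolding vekua_density_def by (cases "\<rho> \<in> D") simp_all
  qed
  have mi: "indicat_real D \<in> borel_measurable borel" using D(1) by (intro borel_measurable_indicator) auto
  have mb: "(\<lambda>\<rho>. (of_nat n - 1) * \<i> / (4 * complex_of_real (Im \<rho>))) \<in> borel_measurable borel"
    by measurable
  have "vekua_density n D w \<in> borel_measurable borel"
    unfolding eq
    by (intro borel_measurable_scaleR borel_measurable_diff borel_measurable_times mb mi
        borel_measurable_divide[OF measurable_compose[OF m cm] m])
  moreover have "norm (vekua_density n D w \<rho>) \<le> 2 * (\<bar>real n - 1\<bar> / (4 * d))" for \<rho>
  proof (cases "\<rho> \<in> D")
    case True
    define b where "b = (of_nat n - 1) * \<i> / (4 * complex_of_real (Im \<rho>))"
    have nb: "norm b \<le> \<bar>real n - 1\<bar> / (4 * d)"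
    proof -
      have "norm b = norm (of_real (real n - 1) :: complex) / (4 * Im \<rho>)"
        using d(1) d(2)[OF True] by (simp add: b_def norm_divide norm_mult)
      also have "\<dots> = \<bar>real n - 1\<bar> / (4 * Im \<rho>)" by (simp only: norm_of_real)
      also have "\<dots> \<le> \<bar>real n - 1\<bar> / (4 * d)" using d(1) d(2)[OF True] by (intro frac_le) auto
      finally show ?thesis .
    qed
    have "norm (cnj (w \<rho>) / w \<rho>) \<le> 1" by (simp add: norm_divide divide_le_eq)
    then have "norm (b * (cnj (w \<rho>) / w \<rho>)) \<le> norm b * 1"
      unfolding norm_mult by (intro mult_left_mono) auto
    moreover have v: "vekua_density n D w \<rho> = b - b * (cnj (w \<rho>) / w \<rho>)"
      using True by (simp add: vekua_density_def b_def)
    ultimately show ?thesis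
      unfolding v using norm_triangle_ineq4[of b "b * (cnj (w \<rho>) / w \<rho>)"] nb by linarith
  next
    case False
    then show ?thesis using d(1) by (simp add: vekua_density_def)
  qed
  moreover have "vekua_density n D w \<rho> = 0" if "R + 1 \<le> norm \<rho>" for \<rho>
    using that R[of \<rho>] closure_subset[of D] by (auto simp: vekua_density_def indicator_def)
  ultimately show ?thesis unfolding bounded_density_def by blast
qed

lemma vekua_density_differentiable:
  assumes "open D" "c \<in> D" "0 < Im c" "w c \<noteq> 0" "w differentiable (at c)"
  shows "vekua_density n D w differentiable (at c)"
proof -
  obtain w' where w': "(w has_derivative w') (at c)" using assms(5) by (auto simp: differentiable_def)
  have im: "((\<lambda>\<rho>. 4 * complex_of_real (Im \<rho>)) has_derivative (\<lambda>h. 4 * of_real (Im h))) (at c)"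
    by (auto intro!: derivative_eq_intros)
  have "4 * complex_of_real (Im c) \<noteq> 0" using assms(3) by simp
  from has_derivative_divide[OF has_derivative_const im this, of "(of_nat n - 1) * \<i>"]
  obtain b' where b: "((\<lambda>\<rho>. (of_nat n - 1) * \<i> / (4 * complex_of_real (Im \<rho>))) has_derivative b') (at c)"
    by blast
  have "((\<lambda>\<rho>. cnj (w \<rho>)) has_derivative (\<lambda>h. cnj (w' h))) (at c)"
    by (rule bounded_linear.has_derivative[OF bounded_linear_cnj w'])
  from has_derivative_divide[OF this w' assms(4)]
  obtain q' where q: "((\<lambda>\<rho>. cnj (w \<rho>) / w \<rho>) has_derivative q') (at c)"
    by blast
  have "(\<lambda>\<rho>. (of_nat n - 1) * \<i> / (4 * complex_of_real (Im \<rho>))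
     - (of_nat n - 1) * \<i> / (4 * of_real (Im \<rho>)) * (cnj (w \<rho>) / w \<rho>)) differentiable (at c)"
    using has_derivative_diff[OF b has_derivative_mult[OF b q]] by (rule differentiableI)
  then show ?thesis
    unfolding differentiable_def
    using has_derivative_transform_within_open[OF _ assms(1,2), where g = "vekua_density n D w"]
    by (fastforce simp: vekua_density_def)
qed

lemma holomorphic_factor:
  assumes D: "open D" "compact (closure D)" "\<And>z. z \<in> closure D \<Longrightarrow> 0 < Im z"
    and w: "continuous_on D w"
    and eq: "\<And>c. c \<in> D \<Longrightarrow> \<exists>P. (w has_derivative
       (\<lambda>h. P * h - (of_nat n - 1) * \<i> / (4 * of_real (Im c)) * (w c - cnj (w c)) * cnj h)) (at c)"
  shows "(\<lambda>z. w z * exp (- vekua_exponent n D w z)) holomorphic_on D"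
proof -
  define f where "f = vekua_density n D w"
  obtain P where P: "\<And>c. c \<in> D \<Longrightarrow> (w has_derivative
       (\<lambda>h. P c * h - (of_nat n - 1) * \<i> / (4 * of_real (Im c)) * (w c - cnj (w c)) * cnj h)) (at c)"
    using eq by metis
  have fw: "f c * w c = (of_nat n - 1) * \<i> / (4 * of_real (Im c)) * (w c - cnj (w c))" if "c \<in> D" for c
  proof -
    have *: "(b - b * (q / x)) * x = b * (x - q)" if "x \<noteq> 0" for b q x :: complex
      using that by (simp add: field_simps)
    have "f c = (of_nat n - 1) * \<i> / (4 * of_real (Im c)) - (of_nat n - 1) * \<i> / (4 * of_real (Im c)) * (cnj (w c) / w c)"
      using that by (simp add: f_def vekua_density_def)
    then show ?thesis using *[of "w c"] by (cases "w c = 0") (simp_all only: mult_zero_right complex_cnj_zero diff_self not_False_eq_True)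
  qed
  have "(\<lambda>z. w z * exp (- (cauchy_transform f z / of_real pi))) holomorphic_on D"
  proof (rule similarity_principle)
    show "bounded_density f"
      unfolding f_def by (rule bounded_density_vekua_density[OF D w])
    show "(w has_derivative (\<lambda>h. P c * h - f c * w c * cnj h)) (at c)" if "c \<in> D" for c
      unfolding fw[OF that] by (rule P[OF that])
    show "f differentiable (at c)" if "c \<in> D" "w c \<noteq> 0" for c
      unfolding f_def using that D(3) closure_subset[of D] P[OF that(1)]
      by (intro vekua_density_differentiable D(1)) (auto simp: differentiable_def)
  qed
  then show ?thesis by (simp add: vekua_exponent_eq_cauchy_transform f_def)
qed

section \<open>The boundary value problem on the disk\<close>

lemma conformal_inverse:
  assumes "open D" and conf: "conformal_onto_disk D \<psi> \<phi>"
  shows "compact (closure D)" "continuous_on (cball 0 1) \<phi>" "\<phi> ` cball 0 1 \<subseteq> closure D"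
    "\<phi> ` sphere 0 1 \<subseteq> frontier D" "\<phi> ` ball 0 1 \<subseteq> D" "\<phi> holomorphic_on ball 0 1"
    "\<And>z. z \<in> D \<Longrightarrow> \<phi> (\<psi> z) = z"
proof -
  have hol: "\<psi> holomorphic_on D" and hom: "homeomorphism (closure D) (cball 0 1) \<psi> \<phi>"
    and im: "\<psi> ` D = ball 0 1" "\<psi> ` frontier D = sphere 0 1"
    using conf unfolding conformal_onto_disk_def by auto
  show cont: "continuous_on (cball 0 1) \<phi>" using hom by (simp add: homeomorphism_def)
  have cl: "\<phi> ` cball 0 1 = closure D" using hom by (simp add: homeomorphism_def)
  then show "\<phi> ` cball 0 1 \<subseteq> closure D" by simp
  show "compact (closure D)" using compact_continuous_image[OF cont compact_cball] cl by simp
  have inv: "\<phi> (\<psi> z) = z" if "z \<in> closure D" for z using hom that by (simp add: homeomorphism_def)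
  have sub: "D \<subseteq> closure D" "frontier D \<subseteq> closure D" by (auto simp: closure_subset frontier_def)
  show "\<phi> (\<psi> z) = z" if "z \<in> D" for z using inv sub that by blast
  show "\<phi> ` sphere 0 1 \<subseteq> frontier D"
    unfolding im(2)[symmetric] using inv sub by auto
  show "\<phi> ` ball 0 1 \<subseteq> D"
    unfolding im(1)[symmetric] using inv sub by auto
  have inj: "inj_on \<psi> D" using inv sub by (intro inj_on_inverseI[of D \<phi>]) auto
  have "\<exists>g. g holomorphic_on \<psi> ` D \<and> (\<forall>z\<in>D. g (\<psi> z) = z)"
  proof (rule holomorphic_has_inverse[OF hol \<open>open D\<close> inj])
    fix g assume "g holomorphic_on \<psi> ` D" "\<And>z. z \<in> D \<Longrightarrow> g (\<psi> z) = z"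
    then show ?thesis by (intro exI[of _ g]) simp
  qed
  then obtain g where g: "g holomorphic_on \<psi> ` D" "\<forall>z\<in>D. g (\<psi> z) = z" by (elim exE conjE)
  have "\<phi> x = g x" if "x \<in> ball 0 1" for x
  proof -
    have "x \<in> \<psi> ` D" using that im(1) by simp
    then obtain z where z: "x = \<psi> z" "z \<in> D" by (rule imageE)
    have "z \<in> closure D" using sub(1) z(2) by (rule subsetD)
    from inv[OF this] bspec[OF g(2) z(2)] show ?thesis by (simp add: z(1))
  qed
  then show "\<phi> holomorphic_on ball 0 1"
    by (intro holomorphic_transform[OF g(1)[unfolded im(1)]]) simp
qed

text \<open>
  On the unit circle $\overline{dt} = -\,dt/t^2$.
\<close>
lemma has_contour_integral_cnj_unit_circle:
  assumes "(f has_contour_integral I) (circlepath 0 1)"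
  shows "((\<lambda>t. - cnj (f t) / t\<^sup>2) has_contour_integral cnj I) (circlepath 0 1)"
proof -
  have "((\<lambda>t. f (0 + of_real 1 * cis t) * of_real 1 * \<i> * cis t) has_integral I) {0..2 * pi}"
    using assms by (simp add: circlepath_def has_contour_integral_part_circlepath_iff)
  then have "(cnj \<circ> (\<lambda>t. f (0 + of_real 1 * cis t) * of_real 1 * \<i> * cis t) has_integral cnj I) {0..2 * pi}"
    by (simp only: has_integral_cnj)
  moreover have "(cnj \<circ> (\<lambda>t. f (0 + of_real 1 * cis t) * of_real 1 * \<i> * cis t))
      = (\<lambda>t. - cnj (f (0 + of_real 1 * cis t)) / (0 + of_real 1 * cis t)\<^sup>2 * of_real 1 * \<i> * cis t)"
    by (auto simp: fun_eq_iff cis_cnj power2_eq_square field_simps cis_mult)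
  ultimately show ?thesis
    by (simp add: circlepath_def has_contour_integral_part_circlepath_iff)
qed

text \<open>
  Write $2\,\mathrm{Re}\,H = H + \bar H$. The kernel is $\frac{2}{t-\gamma} - \frac1t$, so Cauchy's formula gives
  $2 H(\gamma) - H(0)$ for the first summand. On the circle $\bar t = 1/t$, and the integrand of the second
  is the conjugate of $H(t)\,\frac{1 + \bar\gamma t}{1 - \bar\gamma t}\,\frac1t$ up to the conjugate differential;
  this quotient is holomorphic apart from the pole at $0$, so that only $\overline{H(0)}$ remains.
\<close>
theorem schwarz_formula_disk:
  assumes cont: "continuous_on (cball 0 1) H" and hol: "H holomorphic_on ball 0 1"
    and g: "\<gamma> \<in> ball 0 1"
  shows "H \<gamma> = 1 / (2 * of_real pi * \<i>) *
      contour_integral (circlepath 0 1) (\<lambda>t. of_real (Re (H t)) * ((t + \<gamma>) / (t - \<gamma>)) / t)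
    + \<i> * of_real (Im (H 0))"
proof -
  define K where "K u = H u * ((1 + cnj \<gamma> * u) / (1 - cnj \<gamma> * u))" for u
  have nz: "1 - cnj \<gamma> * u \<noteq> 0" if "u \<in> cball 0 1" for u
  proof -
    have "norm (cnj \<gamma> * u) < 1"
      using that g mult_left_le[of "norm u" "norm \<gamma>"] by (auto simp: norm_mult)
    then show ?thesis by auto
  qed
  have c1: "((\<lambda>u. H u / (u - \<gamma>)) has_contour_integral 2 * of_real pi * \<i> * H \<gamma>) (circlepath 0 1)"
    using g by (intro Cauchy_integral_circlepath[OF cont hol]) simp
  have c2: "((\<lambda>u. H u / (u - 0)) has_contour_integral 2 * of_real pi * \<i> * H 0) (circlepath 0 1)"
    by (intro Cauchy_integral_circlepath[OF cont hol]) simp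
  have c3: "((\<lambda>u. K u / (u - 0)) has_contour_integral 2 * of_real pi * \<i> * K 0) (circlepath 0 1)"
  proof (rule Cauchy_integral_circlepath)
    show "continuous_on (cball 0 1) K" unfolding K_def using nz by (intro continuous_intros cont) auto
    show "K holomorphic_on ball 0 1" unfolding K_def using nz by (intro holomorphic_intros hol) auto
  qed simp
  note c4 = has_contour_integral_cnj_unit_circle[OF c3]
  have "((\<lambda>t. (2 * (H t / (t - \<gamma>)) - H t / (t - 0)) / 2 - (- cnj (K t / (t - 0)) / t\<^sup>2) / 2)
      has_contour_integral (2 * (2 * of_real pi * \<i> * H \<gamma>) - 2 * of_real pi * \<i> * H 0) / 2
         - cnj (2 * of_real pi * \<i> * K 0) / 2) (circlepath 0 1)"
    by (intro has_contour_integral_diff has_contour_integral_div has_contour_integral_lmul c1 c2 c4)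
  then have "((\<lambda>t. of_real (Re (H t)) * ((t + \<gamma>) / (t - \<gamma>)) / t)
      has_contour_integral (2 * (2 * of_real pi * \<i> * H \<gamma>) - 2 * of_real pi * \<i> * H 0) / 2
         - cnj (2 * of_real pi * \<i> * K 0) / 2) (circlepath 0 1)"
  proof (rule has_contour_integral_eq)
    fix t assume "t \<in> path_image (circlepath 0 1)"
    then have n: "norm t = 1" by simp
    then have t: "t \<noteq> 0" "t \<noteq> \<gamma>" using g by auto
    moreover have "t * cnj t = 1" using n complex_norm_square[of t] by simp
    ultimately have "cnj t = 1 / t" by (metis nonzero_eq_divide_eq mult.commute)
    note t = t this
    have K: "cnj (K t) = cnj (H t) * ((t + \<gamma>) / (t - \<gamma>))"
    proof -
      have "(1 + \<gamma> * (1 / t)) / (1 - \<gamma> * (1 / t)) = (t + \<gamma>) / (t - \<gamma>)"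
        using t by (simp add: divide_simps)
      then show ?thesis
        by (simp only: K_def complex_cnj_mult complex_cnj_divide complex_cnj_add complex_cnj_diff
            complex_cnj_one complex_cnj_cnj t)
    qed
    have KK: "- cnj (K t / (t - 0)) / t\<^sup>2 = - (cnj (H t) * ((t + \<gamma>) / (t - \<gamma>)) / t)"
      unfolding complex_cnj_divide K using t by (simp add: power2_eq_square)
    have HH: "2 * (H t / (t - \<gamma>)) - H t / (t - 0) = H t * ((t + \<gamma>) / (t - \<gamma>)) / t"
      using t by (simp add: divide_simps) (simp add: algebra_simps)
    have re: "complex_of_real (Re (H t)) = (H t + cnj (H t)) / 2" by (simp add: complex_add_cnj)
    show "(2 * (H t / (t - \<gamma>)) - H t / (t - 0)) / 2 - (- cnj (K t / (t - 0)) / t\<^sup>2) / 2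
       = of_real (Re (H t)) * ((t + \<gamma>) / (t - \<gamma>)) / t"
    proof -
      have "a * q / t / 2 - - (b * q / t) / 2 = (a + b) / 2 * q / t" for a b q :: complex
        using t(1) by (simp add: field_simps)
      then show ?thesis unfolding re KK HH .
    qed
  qed
  then have "contour_integral (circlepath 0 1) (\<lambda>t. of_real (Re (H t)) * ((t + \<gamma>) / (t - \<gamma>)) / t)
      = (2 * (2 * of_real pi * \<i> * H \<gamma>) - 2 * of_real pi * \<i> * H 0) / 2 - cnj (2 * of_real pi * \<i> * K 0) / 2"
    by (rule contour_integral_unique)
  also have "\<dots> = 2 * of_real pi * \<i> * (H \<gamma> - (H 0 - cnj (H 0)) / 2)"
    by (simp add: K_def field_simps)
  also have "(H 0 - cnj (H 0)) / 2 = \<i> * of_real (Im (H 0))"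
    by (simp add: complex_diff_cnj)
  finally show ?thesis by simp
qed

text \<open>
  A function $e^{\mathrm{i} a}$ with $a$ continuous on the circle has winding number $0$: the function
  $(a + m\theta - q)/2\pi$ of $\theta$ is continuous and integer-valued on $[0, 2\pi]$, so its values at the end points,
  which differ by $m$, agree.
\<close>
lemma index_of_continuous_argument:
  fixes a q :: "complex \<Rightarrow> real" and m :: int
  assumes a: "continuous_on (sphere 0 1) a" and q: "continuous_on (sphere 0 1) q"
    and eq: "\<And>\<gamma>. \<gamma> \<in> sphere 0 1 \<Longrightarrow> exp (\<i> * of_real (a \<gamma>)) = \<gamma> powi (- m) * exp (\<i> * of_real (q \<gamma>))"
  shows "m = 0"
proof -
  define h where "h \<theta> = (a (cis \<theta>) + of_int m * \<theta> - q (cis \<theta>)) / (2 * pi)" for \<theta>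
  have int: "h \<theta> \<in> \<int>" for \<theta>
  proof -
    have "exp (\<i> * of_real (a (cis \<theta>))) = cis \<theta> powi (- m) * exp (\<i> * of_real (q (cis \<theta>)))"
      by (rule eq) simp
    also have "cis \<theta> powi (- m) = exp (\<i> * of_real (- of_int m * \<theta>))"
      by (subst cis_power_int) (simp add: cis_conv_exp)
    finally have "exp (\<i> * of_real (a (cis \<theta>))) = exp (\<i> * of_real (- of_int m * \<theta> + q (cis \<theta>)))"
      by (simp add: exp_add[symmetric] algebra_simps)
    then obtain k :: int where "\<i> * of_real (a (cis \<theta>)) = \<i> * of_real (- of_int m * \<theta> + q (cis \<theta>)) + of_int (2 * k) * pi * \<i>"
      unfolding exp_eq by blast
    then have "a (cis \<theta>) = - of_int m * \<theta> + q (cis \<theta>) + 2 * of_int k * pi"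
      by (simp add: complex_eq_iff)
    then have "h \<theta> = of_int k" by (simp add: h_def field_simps)
    then show ?thesis by simp
  qed
  have cont: "continuous_on {0..2 * pi} h"
    unfolding h_def
    by (intro continuous_intros continuous_on_compose2[OF a] continuous_on_compose2[OF q]) auto
  have "h constant_on {0..2 * pi}"
  proof (rule continuous_discrete_range_constant[OF _ cont])
    show "\<exists>e>0. \<forall>y. y \<in> {0..2 * pi} \<and> h y \<noteq> h x \<longrightarrow> e \<le> norm (h y - h x)" for x
    proof (intro exI[of _ 1] conjI allI impI)
      fix y assume "y \<in> {0..2 * pi} \<and> h y \<noteq> h x"
      moreover obtain k l where kl: "h y = of_int k" "h x = of_int l"
        using int[of x] int[of y] by (auto elim!: Ints_cases)
      ultimately have "1 \<le> \<bar>k - l\<bar>" by auto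
      then show "1 \<le> norm (h y - h x)"
        by (simp only: kl real_norm_def of_int_diff[symmetric] of_int_abs[symmetric] of_int_1_le_iff)
    qed simp
  qed simp
  then have "h 0 = h (2 * pi)" unfolding constant_on_def by force
  moreover have "h 0 = (a 1 - q 1) / (2 * pi)" "h (2 * pi) = (a 1 - q 1) / (2 * pi) + of_int m"
    by (simp_all add: h_def add_divide_distrib diff_divide_distrib)
  ultimately show ?thesis by simp
qed

text \<open>
  With index $0$, the factorization of $e^N$ turns the boundary condition into one for the real part of
  $\Psi e^{\chi}$: on the circle $\Psi e^N = |e^N| e^{-\mathrm{Re}\,\chi}\,\Psi e^{\chi}$ with a positive factor. So
  $\Psi e^{\chi}$ is given by the Schwarz formula, up to an imaginary constant.
\<close>
lemma riemann_hilbert_disk_solution: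
  fixes N \<Psi> chi :: "complex \<Rightarrow> complex" and g0 :: "complex \<Rightarrow> real"
  assumes idx: "index_factorization (\<lambda>\<gamma>. exp (N \<gamma>)) m chi"
    and N: "continuous_on (sphere 0 1) N"
    and \<Psi>: "continuous_on (cball 0 1) \<Psi>" "\<Psi> holomorphic_on ball 0 1"
    and bd: "\<And>t. t \<in> sphere 0 1 \<Longrightarrow> Re (\<Psi> t * exp (N t)) = g0 t"
  shows "m = 0"
    and "\<exists>y::real. \<forall>\<gamma>\<in>ball 0 1. \<Psi> \<gamma> = exp (- chi \<gamma>) / (2 * of_real pi * \<i>) *
        contour_integral (circlepath 0 1)
          (\<lambda>t. of_real (g0 t * exp (Re (chi t)) / cmod (exp (N t))) * ((t + \<gamma>) / (t - \<gamma>)) / t)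
      + exp (- chi \<gamma>) * (\<i> * of_real y)"
proof -
  have chi: "chi holomorphic_on ball 0 1" "continuous_on (cball 0 1) chi"
    and fac: "\<And>\<gamma>. \<gamma> \<in> sphere 0 1 \<Longrightarrow> exp (N \<gamma>) = of_real (cmod (exp (N \<gamma>))) * \<gamma> powi (- m) * exp (chi \<gamma>) * exp (- of_real (Re (chi \<gamma>)))"
    using idx unfolding index_factorization_def by blast+
  have rot: "exp z * exp (- of_real (Re z)) = exp (\<i> * of_real (Im z))" for z :: complex
  proof -
    have "z + - of_real (Re z) = \<i> * of_real (Im z)" by (simp add: complex_eq_iff)
    then show ?thesis by (simp only: exp_add[symmetric])
  qed
  show m: "m = 0"
  proof (rule index_of_continuous_argument)
    show "continuous_on (sphere 0 1) (\<lambda>\<gamma>. Im (N \<gamma>))" by (intro continuous_intros N)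
    show "continuous_on (sphere 0 1) (\<lambda>\<gamma>. Im (chi \<gamma>))"
      by (intro continuous_intros continuous_on_subset[OF chi(2)]) auto
    fix \<gamma> :: complex assume \<gamma>: "\<gamma> \<in> sphere 0 1"
    have "of_real (exp (Re (N \<gamma>))) * exp (\<i> * of_real (Im (N \<gamma>))) = exp (N \<gamma>)"
      unfolding rot[symmetric] by (simp add: exp_minus exp_of_real)
    also have "\<dots> = of_real (exp (Re (N \<gamma>))) * (\<gamma> powi (- m) * exp (\<i> * of_real (Im (chi \<gamma>))))"
      using fac[OF \<gamma>] by (simp only: norm_exp_eq_Re rot[symmetric] mult.assoc)
    finally show "exp (\<i> * of_real (Im (N \<gamma>))) = \<gamma> powi (- m) * exp (\<i> * of_real (Im (chi \<gamma>)))"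
      by simp
  qed
  define H where "H \<gamma> = \<Psi> \<gamma> * exp (chi \<gamma>)" for \<gamma>
  have H: "continuous_on (cball 0 1) H" "H holomorphic_on ball 0 1"
    unfolding H_def by (intro continuous_intros holomorphic_intros \<Psi> chi)+
  have ReH: "Re (H t) = g0 t * exp (Re (chi t)) / cmod (exp (N t))" if t: "t \<in> sphere 0 1" for t
  proof -
    define a where "a = cmod (exp (N t))"
    have a: "a \<noteq> 0" by (simp add: a_def)
    have "exp (N t) = of_real a * exp (chi t) * exp (- of_real (Re (chi t)))"
      using fac[OF t] unfolding m a_def by (simp only: minus_zero power_int_0_right mult_1_right)
    then have "\<Psi> t * exp (N t) = of_real (a / exp (Re (chi t))) * H t"
      by (simp add: H_def exp_minus exp_of_real field_simps)
    then have "g0 t = Re (of_real (a / exp (Re (chi t))) * H t)"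
      using bd[OF t] by simp
    also have "\<dots> = a / exp (Re (chi t)) * Re (H t)" by (simp del: of_real_divide)
    finally show ?thesis using a unfolding a_def[symmetric] by simp
  qed
  have "\<Psi> \<gamma> = exp (- chi \<gamma>) / (2 * of_real pi * \<i>) *
        contour_integral (circlepath 0 1)
          (\<lambda>t. of_real (g0 t * exp (Re (chi t)) / cmod (exp (N t))) * ((t + \<gamma>) / (t - \<gamma>)) / t)
      + exp (- chi \<gamma>) * (\<i> * of_real (Im (H 0)))" if \<gamma>: "\<gamma> \<in> ball 0 1" for \<gamma>
  proof -
    have CI: "contour_integral (circlepath 0 1) (\<lambda>t. of_real (Re (H t)) * ((t + \<gamma>) / (t - \<gamma>)) / t)
       = contour_integral (circlepath 0 1)
          (\<lambda>t. of_real (g0 t * exp (Re (chi t)) / cmod (exp (N t))) * ((t + \<gamma>) / (t - \<gamma>)) / t)"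
    proof (rule contour_integral_cong)
      show "of_real (Re (H t)) * ((t + \<gamma>) / (t - \<gamma>)) / t
          = of_real (g0 t * exp (Re (chi t)) / cmod (exp (N t))) * ((t + \<gamma>) / (t - \<gamma>)) / t"
        if "t \<in> path_image (circlepath 0 1)" for t
        using that ReH[of t] by simp
    qed simp
    have "\<Psi> \<gamma> = exp (- chi \<gamma>) * H \<gamma>" by (simp add: H_def exp_minus)
    then show ?thesis
      unfolding schwarz_formula_disk[OF H \<gamma>] CI by (simp add: distrib_left)
  qed
  then show "\<exists>y::real. \<forall>\<gamma>\<in>ball 0 1. \<Psi> \<gamma> = exp (- chi \<gamma>) / (2 * of_real pi * \<i>) *
        contour_integral (circlepath 0 1)
          (\<lambda>t. of_real (g0 t * exp (Re (chi t)) / cmod (exp (N t))) * ((t + \<gamma>) / (t - \<gamma>)) / t)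
      + exp (- chi \<gamma>) * (\<i> * of_real y)" by blast
qed

theorem theorem4p2:
  fixes \<Omega> :: "'n::{finite,linorder} point set"
    and D :: "complex set"
    and \<alpha> \<mu> :: real
    and g :: "'n point \<Rightarrow> real" and g_plane :: "complex \<Rightarrow> real"
    and \<psi> \<phi>inv :: "complex \<Rightarrow> complex"
    and \<phi> :: "'n point \<Rightarrow> 'n clifford"
  assumes mu: "0 < \<mu>" "\<mu> \<le> 1"
    and domain: "open \<Omega>" "connected \<Omega>" "\<Omega> \<noteq> {}"
    and symmetric: "axially_symmetric \<Omega>"
    and smooth: "smooth_boundary \<Omega>"
    and projection: "D = axial_coord ` \<Omega>"
    and upper: "D \<subseteq> {z. Im z > 0}"
    and simply: "simply_connected D"
    and holder: "holder_on \<mu> (frontier \<Omega>) g"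
    and axial_data: "\<And>t. t \<in> frontier \<Omega> \<Longrightarrow> g t = g_plane (axial_coord t)"
    and conformal: "conformal_onto_disk D \<psi> \<phi>inv"
    and solution: "rh_solution \<alpha> \<Omega> g \<phi>"
  shows "\<exists>w \<Psi> \<Psi>h :: complex \<Rightarrow> complex.
    (\<forall>x\<in>\<Omega>. \<forall>\<omega>. norm \<omega> = 1 \<and> snd x = norm (snd x) *\<^sub>R \<omega> \<longrightarrow>
       \<phi> x = exp (\<alpha> * fst x) *\<^sub>R
         (cl_scalar (Re (w (Complex (fst x) (norm (snd x)))))
          + Im (w (Complex (fst x) (norm (snd x)))) *\<^sub>R cl_vector \<omega>)) \<and>
    (let \<nu> = vekua_exponent CARD('n) D w;
         \<nu>h = (\<lambda>\<gamma>. \<nu> (\<phi>inv \<gamma>));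
         g0 = (\<lambda>z. exp (- \<alpha> * Re z) * g_plane z);
         g0h = (\<lambda>\<gamma>. g0 (\<phi>inv \<gamma>));
         lamh = (\<lambda>\<gamma>. 1 :: complex);
         lamh0 = (\<lambda>\<gamma>. lamh \<gamma> * exp (\<nu>h \<gamma>))
     in (\<forall>z\<in>D. w z = \<Psi> z * exp (\<nu> z)) \<and>
        (\<forall>z\<in>D. \<Psi> z = \<Psi>h (\<psi> z)) \<and>
        (\<forall>m chi. index_factorization lamh0 m chi \<longrightarrow>
          (let g4h = (\<lambda>\<gamma>. g0h \<gamma> * exp (Re (chi \<gamma>)) / cmod (exp (\<nu>h \<gamma>)))
           in (m \<ge> 0 \<longrightarrow>
                (\<exists>c :: nat \<Rightarrow> complex.
                  (\<forall>k\<le>nat m. c (2 * nat m - k) = - cnj (c k)) \<and>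
                  (\<forall>\<gamma>\<in>ball 0 1. \<Psi>h \<gamma> =
                     \<gamma> powi m * exp (- chi \<gamma>) / (2 * of_real pi * \<i>) *
                       contour_integral (circlepath 0 1)
                         (\<lambda>t. of_real (g4h t) * ((t + \<gamma>) / (t - \<gamma>)) / t)
                     + exp (- chi \<gamma>) * (\<Sum>k=0..2 * nat m. c k * \<gamma> ^ k)))) \<and>
              (m < 0 \<longrightarrow>
                ((\<forall>\<gamma>\<in>ball 0 1. \<Psi>h \<gamma> =
                    exp (- chi \<gamma>) / (of_real pi * \<i>) *
                      contour_integral (circlepath 0 1)
                        (\<lambda>t. of_real (g4h t) * t powi m / (t - \<gamma>)))
                 \<longleftrightarrow>
                 (\<forall>k::int. 0 \<le> k \<and> k \<le> - m + 1 \<longrightarrow>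
                    integral {0..2 * pi}
                      (\<lambda>\<theta>. of_real (g4h (exp (\<i> * of_real \<theta>))) * exp (- of_int k * \<i> * of_real \<theta>))
                    = (0 :: complex)))))))"
proof -
  note \<Omega> = domain(1) symmetric smooth
  note up = upper[unfolded projection]
  \<comment> \<open>any coordinate direction spans a meridian half-plane together with the axis\<close>
  obtain j :: 'n where True by simp
  obtain A B where ck: "ck_on 1 \<phi> \<Omega>" and cont: "continuous_on (closure \<Omega>) \<phi>"
    and pde: "\<And>x. x \<in> \<Omega> \<Longrightarrow> cauchy_riemann \<phi> x - \<alpha> *\<^sub>R \<phi> x = 0"
    and rep: "axial_rep (closure \<Omega>) \<phi> A B"
    and bdry: "\<And>t. t \<in> frontier \<Omega> \<Longrightarrow> A (fst t) (norm (snd t)) = g t"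
    using solution unfolding rh_solution_def by blast
  have rep': "axial_rep \<Omega> \<phi> A B"
    using rep closure_subset unfolding axial_rep_def by blast
  have opD: "open D" unfolding projection by (rule open_meridian_domain[OF \<Omega> up])
  have clD: "0 < Im z" "meridian_point j z \<in> closure \<Omega>" if "z \<in> closure D" for z
    using closure_meridian_domain[OF \<Omega> up, of z j] that unfolding projection by auto
  have frD: "meridian_point j z \<in> frontier \<Omega>" if "z \<in> frontier D" for z
    using frontier_meridian_domain[OF \<Omega> up, of z j] that unfolding projection by auto
  note conf = conformal_inverse[OF opD conformal]
  have subD: "D \<subseteq> closure D" "frontier D \<subseteq> closure D" by (auto simp: closure_subset frontier_def)
  define w where "w = meridian_function \<alpha> j \<phi>"
  define \<nu> where "\<nu> = vekua_exponent CARD('n) D w"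
  define \<Psi> where "\<Psi> z = w z * exp (- \<nu> z)" for z
  have w_eq: "w z = of_real (exp (- \<alpha> * Re z)) * Complex (A (Re z) (Im z)) (B (Re z) (Im z))"
    if "z \<in> closure D" for z
    using axial_rep_meridian_point[OF rep clD(2)[OF that] clD(1)[OF that]]
    by (simp add: w_def meridian_function_def)
  have w_cont: "continuous_on (closure D) w"
  proof -
    have "continuous_on (closure D) (\<lambda>z. \<phi> (meridian_point j z))"
      by (rule continuous_on_compose2[OF cont continuous_on_meridian_point]) (use clD(2) in auto)
    then show ?thesis
      unfolding w_def meridian_function_def[abs_def] Complex_eq by (intro continuous_intros)
  qed
  have hol: "\<Psi> holomorphic_on D"
    unfolding \<Psi>_def[abs_def] \<nu>_def
  proof (rule holomorphic_factor[OF opD conf(1) clD(1)])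
    show "continuous_on D w" by (rule continuous_on_subset[OF w_cont subD(1)])
    fix c assume c: "c \<in> D"
    have r: "0 < Im c" using upper c by blast
    have x: "meridian_point j c \<in> \<Omega>"
      using meridian_point_mem_iff[OF symmetric less_imp_le[OF r], of j] c projection by blast
    then have "\<phi> differentiable (at (meridian_point j c))" using ck by simp
    from vekua_equation[OF symmetric rep' x r this pde[OF x]]
    show "\<exists>P. (w has_derivative (\<lambda>h. P * h - (of_nat CARD('n) - 1) * \<i> / (4 * of_real (Im c)) * (w c - cnj (w c)) * cnj h)) (at c)"
      unfolding w_def .
  qed
  have \<nu>_cont: "continuous_on UNIV \<nu>"
  proof -
    have "bounded_density (vekua_density CARD('n) D w)"
      by (rule bounded_density_vekua_density[OF opD conf(1) clD(1) continuous_on_subset[OF w_cont subD(1)]])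
    then show ?thesis
      unfolding \<nu>_def vekua_exponent_eq_cauchy_transform[abs_def]
      by (intro continuous_intros continuous_on_cauchy_transform) auto
  qed
  define \<Psi>h where "\<Psi>h = \<Psi> \<circ> \<phi>inv"
  have \<Psi>h_hol: "\<Psi>h holomorphic_on ball 0 1"
    unfolding \<Psi>h_def by (rule holomorphic_on_compose_gen[OF conf(6) hol conf(5)])
  have \<Psi>h_cont: "continuous_on (cball 0 1) \<Psi>h"
  proof -
    have "continuous_on (closure D) \<Psi>"
      unfolding \<Psi>_def[abs_def] by (intro continuous_intros w_cont continuous_on_subset[OF \<nu>_cont]) auto
    then show ?thesis unfolding \<Psi>h_def
      by (intro continuous_on_compose conf(2)) (rule continuous_on_subset[OF _ conf(3)])
  qed
  have \<nu>h_cont: "continuous_on (sphere 0 1) (\<lambda>\<gamma>. \<nu> (\<phi>inv \<gamma>))"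
    by (rule continuous_on_compose2[OF \<nu>_cont continuous_on_subset[OF conf(2)]]) auto
  have bd: "Re (\<Psi>h t * exp (\<nu> (\<phi>inv t))) = exp (- \<alpha> * Re (\<phi>inv t)) * g_plane (\<phi>inv t)"
    if t: "t \<in> sphere 0 1" for t
  proof -
    define z where "z = \<phi>inv t"
    have z: "z \<in> frontier D" using conf(4) t by (auto simp: z_def)
    then have zc: "z \<in> closure D" using subD by blast
    have "A (Re z) (Im z) = g (meridian_point j z)"
      using bdry[OF frD[OF z]] clD(1)[OF zc] by (simp add: meridian_point_def)
    also have "\<dots> = g_plane z"
      using axial_data[OF frD[OF z]] clD(1)[OF zc] by (simp add: axial_coord_meridian_point)
    finally have "Re (w z) = exp (- \<alpha> * Re z) * g_plane z"
      using w_eq[OF zc] by simp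
    moreover have "\<Psi>h t * exp (\<nu> z) = w z"
      by (simp add: \<Psi>h_def \<Psi>_def z_def exp_minus)
    ultimately show ?thesis by (simp add: z_def)
  qed
  have form: "\<phi> x = exp (\<alpha> * fst x) *\<^sub>R
         (cl_scalar (Re (w (Complex (fst x) (norm (snd x)))))
          + Im (w (Complex (fst x) (norm (snd x)))) *\<^sub>R cl_vector \<omega>)"
    if "x \<in> \<Omega>" "norm \<omega> = 1" "snd x = norm (snd x) *\<^sub>R \<omega>" for x \<omega>
  proof -
    have "axial_coord x \<in> closure D" using that(1) subD(1) projection by blast
    then have "Complex (fst x) (norm (snd x)) \<in> closure D" by (simp add: axial_coord_def)
    from w_eq[OF this] have "Re (w (Complex (fst x) (norm (snd x)))) = exp (- \<alpha> * fst x) * A (fst x) (norm (snd x))"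
      "Im (w (Complex (fst x) (norm (snd x)))) = exp (- \<alpha> * fst x) * B (fst x) (norm (snd x))" by simp_all
    moreover have "\<phi> x = cl_scalar (A (fst x) (norm (snd x))) + B (fst x) (norm (snd x)) *\<^sub>R cl_vector \<omega>"
      using rep' that unfolding axial_rep_def by blast
    moreover have "exp (\<alpha> * fst x) * exp (- \<alpha> * fst x) = 1"
      by (simp add: exp_add[symmetric])
    ultimately show ?thesis
      by (simp only: cl_scalar_def scaleR_add_right scaleR_scaleR mult.assoc[symmetric] mult_1_left)
  qed
  have disk: "m = 0 \<and> (\<exists>y::real. \<forall>\<gamma>\<in>ball 0 1. \<Psi>h \<gamma> = exp (- chi \<gamma>) / (2 * of_real pi * \<i>) *
        contour_integral (circlepath 0 1)
          (\<lambda>t. of_real (exp (- \<alpha> * Re (\<phi>inv t)) * g_plane (\<phi>inv t) * exp (Re (chi t)) / cmod (exp (\<nu> (\<phi>inv t))))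
             * ((t + \<gamma>) / (t - \<gamma>)) / t)
      + exp (- chi \<gamma>) * (\<i> * of_real y))"
    if "index_factorization (\<lambda>\<gamma>. 1 * exp (\<nu> (\<phi>inv \<gamma>))) m chi" for m chi
    using riemann_hilbert_disk_solution[OF that[unfolded mult_1_left] \<nu>h_cont \<Psi>h_cont \<Psi>h_hol bd] by blast
  show ?thesis
    unfolding Let_def \<nu>_def[symmetric]
  proof (rule exI[of _ w], rule exI[of _ \<Psi>], rule exI[of _ \<Psi>h], unfold \<nu>_def[symmetric], intro conjI ballI allI impI)
    fix m chi
    assume idx: "index_factorization (\<lambda>\<gamma>. 1 * exp (\<nu> (\<phi>inv \<gamma>))) m chi"
    note disk = disk[OF idx]
    {
      assume "0 \<le> m"
      obtain y :: real where y: "\<And>\<gamma>. \<gamma> \<in> ball 0 1 \<Longrightarrow> \<Psi>h \<gamma> = exp (- chi \<gamma>) / (2 * of_real pi * \<i>) *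
        contour_integral (circlepath 0 1)
          (\<lambda>t. of_real (exp (- \<alpha> * Re (\<phi>inv t)) * g_plane (\<phi>inv t) * exp (Re (chi t)) / cmod (exp (\<nu> (\<phi>inv t))))
             * ((t + \<gamma>) / (t - \<gamma>)) / t)
          + exp (- chi \<gamma>) * (\<i> * of_real y)"
        using disk by blast
      show "\<exists>c :: nat \<Rightarrow> complex. (\<forall>k\<le>nat m. c (2 * nat m - k) = - cnj (c k)) \<and>
          (\<forall>\<gamma>\<in>ball 0 1. \<Psi>h \<gamma> = \<gamma> powi m * exp (- chi \<gamma>) / (2 * of_real pi * \<i>) *
             contour_integral (circlepath 0 1)
              (\<lambda>t. of_real (exp (- \<alpha> * Re (\<phi>inv t)) * g_plane (\<phi>inv t) * exp (Re (chi t)) / cmod (exp (\<nu> (\<phi>inv t))))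
                 * ((t + \<gamma>) / (t - \<gamma>)) / t)
             + exp (- chi \<gamma>) * (\<Sum>k=0..2 * nat m. c k * \<gamma> ^ k))"
      \<comment> \<open>as $m = 0$, only the imaginary constant $c_0 = \mathrm{i} y$ enters the sum\<close>
      proof (intro exI[of _ "\<lambda>k. \<i> * of_real y"] conjI ballI)
        fix \<gamma> :: complex assume \<gamma>: "\<gamma> \<in> ball 0 1"
        have m: "m = 0" using disk by blast
        show "\<Psi>h \<gamma> = \<gamma> powi m * exp (- chi \<gamma>) / (2 * of_real pi * \<i>) *
             contour_integral (circlepath 0 1)
              (\<lambda>t. of_real (exp (- \<alpha> * Re (\<phi>inv t)) * g_plane (\<phi>inv t) * exp (Re (chi t)) / cmod (exp (\<nu> (\<phi>inv t))))
                 * ((t + \<gamma>) / (t - \<gamma>)) / t)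
             + exp (- chi \<gamma>) * (\<Sum>k=0..2 * nat m. \<i> * of_real y * \<gamma> ^ k)"
          using y[OF \<gamma>] unfolding m by (simp only: power_int_0_right mult_1_left nat_zero_as_int[symmetric] nat_0 mult_0_right atLeastAtMost_singleton sum.insert finite.emptyI empty_iff not_False_eq_True sum.empty add_0_right power_0 mult_1_right)
      qed simp
    }
    assume "m < 0"
    with disk have False by simp
    then show "(\<forall>\<gamma>\<in>ball 0 1. \<Psi>h \<gamma> =
                    exp (- chi \<gamma>) / (of_real pi * \<i>) *
                      contour_integral (circlepath 0 1)
                        (\<lambda>t. of_real (exp (- \<alpha> * Re (\<phi>inv t)) * g_plane (\<phi>inv t) * exp (Re (chi t)) / cmod (exp (\<nu> (\<phi>inv t)))) * t powi m / (t - \<gamma>)))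
                 \<longleftrightarrow>
                 (\<forall>k::int. 0 \<le> k \<and> k \<le> - m + 1 \<longrightarrow>
                    integral {0..2 * pi}
                      (\<lambda>\<theta>. of_real (exp (- \<alpha> * Re (\<phi>inv (exp (\<i> * of_real \<theta>)))) * g_plane (\<phi>inv (exp (\<i> * of_real \<theta>))) *
                         exp (Re (chi (exp (\<i> * of_real \<theta>)))) / cmod (exp (\<nu> (\<phi>inv (exp (\<i> * of_real \<theta>)))))) * exp (- of_int k * \<i> * of_real \<theta>))
                    = (0 :: complex))" ..
  qed (use form conf(7) in \<open>auto simp: \<Psi>_def \<Psi>h_def exp_minus\<close>)
qed

end
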